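(* The following groups are invariably generated: (1) the Higman--Thompson group $F_n$ for every integer $n \geq 3$; (2) the golden ratio Thompson group $F_\tau$.
   Context: A group $G$ is invariably generated if for every map $\chi\colon G \to G$ the set $\{\chi(g)\, g\, \chi(g)^{-1} : g \in G\}$ generates $G$. For an integer $n\ge 2$, the Higman--Thompson group $F_n$ is the group (under composition) of orientation preserving piecewise linear homeomorphisms of $[0,1]$ (finitely many affine pieces) all of whose slopes are (integer) powers of $n$ and all of whose breakpoints lie in $\mathbb{Z}[1/n]$. The golden ratio Thompson group $F_\tau$ is the group of orientation preserving piecewise linear homeomorphisms of $[0,1]$ (finitely many affine pieces) all of whose breakpoints lie in $\mathbb{Z}[\tau]$ and all of whose slopes are (integer) powers of $\tau$, where $\tau = (\sqrt{5}-1)/2$. *)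

theory Defs
  imports
    "HOL-Analysis.Analysis"
    "HOL-Algebra.Generated_Groups"
    "HOL-Algebra.Bij"
    "HOL-Computational_Algebra.Polynomial"
begin

definition invariably_generated :: "('a, 'b) monoid_scheme \<Rightarrow> bool" where
  "invariably_generated G \<longleftrightarrow>
     group G \<and>
     (\<forall>\<kappa> \<in> carrier G \<rightarrow> carrier G.
        generate G {\<kappa> g \<otimes>\<^bsub>G\<^esub> g \<otimes>\<^bsub>G\<^esub> inv\<^bsub>G\<^esub> (\<kappa> g) |g. g \<in> carrier G} = carrier G)"

definition affine_with_slope :: "real \<Rightarrow> (real \<Rightarrow> real) \<Rightarrow> real set \<Rightarrow> bool" where
  "affine_with_slope s f S \<longleftrightarrow> (\<exists>c. \<forall>t\<in>S. f t = s * t + c)"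

text \<open>Finitely many affine pieces: the finite set \<open>B\<close> subdivides the unit interval.\<close>

definition piecewise_linear :: "(real \<Rightarrow> real) \<Rightarrow> bool" where
  "piecewise_linear f \<longleftrightarrow>
     (\<exists>B. finite B \<and>
        (\<forall>x y. 0 \<le> x \<and> x < y \<and> y \<le> 1 \<and> {x<..<y} \<inter> B = {} \<longrightarrow>
           (\<exists>s. affine_with_slope s f {x..y})))"

text \<open>The endpoints \<open>0\<close> and \<open>1\<close> are not counted as breakpoints; this makes no difference
  below, since they belong to every subring of the reals.\<close>

definition breakpoints :: "(real \<Rightarrow> real) \<Rightarrow> real set" where
  "breakpoints f =
     {x \<in> {0<..<1}. \<not> (\<exists>e>0. \<exists>s. affine_with_slope s f {x - e<..<x + e})}"

definition slopes :: "(real \<Rightarrow> real) \<Rightarrow> real set" where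
  "slopes f = {s. \<exists>x y. 0 \<le> x \<and> x < y \<and> y \<le> 1 \<and> affine_with_slope s f {x..y}}"

text \<open>The product of \<open>BijGroup\<close> is composition; its elements take the value \<open>undefined\<close>
  outside the unit interval, so that equality of elements is equality as maps of \<open>[0,1]\<close>.\<close>

definition PL_group :: "real set \<Rightarrow> real set \<Rightarrow> (real \<Rightarrow> real) monoid" where
  "PL_group A P = (BijGroup {0..1})
     \<lparr>carrier := {f \<in> carrier (BijGroup {0..1}).
        (\<exists>g. homeomorphism {0..1} {0..1} f g) \<and> strict_mono_on {0..1} f \<and>
        piecewise_linear f \<and> breakpoints f \<subseteq> A \<and> slopes f \<subseteq> P}\<rparr>"

text \<open>The subring \<open>\<int>[x]\<close> of the reals.\<close>

definition int_adjoin :: "real \<Rightarrow> real set" where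
  "int_adjoin x = range (\<lambda>p :: int poly. poly (map_poly of_int p) x)"

definition int_powers :: "real \<Rightarrow> real set" where
  "int_powers x = range (\<lambda>k :: int. x powi k)"

definition higman_thompson_F :: "nat \<Rightarrow> (real \<Rightarrow> real) monoid" where
  "higman_thompson_F n = PL_group (int_adjoin (1 / real n)) (int_powers (real n))"

definition golden_tau :: real where
  "golden_tau = (sqrt 5 - 1) / 2"

definition golden_F :: "(real \<Rightarrow> real) monoid" where
  "golden_F = PL_group (int_adjoin golden_tau) (int_powers golden_tau)"

end

theory Submission
  imports Defs
begin

text \<open>
Both families satisfy one dynamical criterion, \<open>cyclic_germs.invariably_generated\<close>: let \<open>G\<close> be a
group of increasing homeomorphisms of \<open>[0,1]\<close> with an element \<open>f\<close> such that \<open>f x < x\<close> on \<open>(0,1)\<close> and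
such that every element of \<open>G\<close> agrees near \<open>0\<close> with a power of \<open>f\<close> and near \<open>1\<close> with a (possibly
different) power of \<open>f\<close>. Then every subgroup \<open>H\<close> that meets all conjugacy classes is \<open>G\<close>.

The hypotheses on \<open>f\<close> pass to its conjugates and \<open>H\<close> contains one of them, so let \<open>f \<in> H\<close>.
The key step (\<open>agrees_on_compact\<close>) is that on each compact interval in \<open>(0,1)\<close> every \<open>p \<in> G\<close>
coincides with some element of \<open>H\<close>. Dividing by a power of \<open>f\<close>, let \<open>p\<close> be the identity near \<open>0\<close>, and
choose \<open>J = [j0,j1]\<close> containing the given interval and everything on which \<open>p\<close> is not a power of \<open>f\<close>.
Put \<open>g = f\<^sup>m p\<close> with \<open>m\<close> so large that \<open>g\<close> pushes \<open>J\<close> to the left of \<open>J\<close>. An orbit of \<open>g\<close> that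
meets \<open>J\<close> comes from near \<open>1\<close> along a power of \<open>f\<close>, feels \<open>p\<close> exactly once, when it leaves \<open>J\<close>, and
after that follows \<open>f\<^sup>m\<close> towards \<open>0\<close>. Now \<open>H\<close> contains some conjugate \<open>c g c\<inverse>\<close>. The conjugator \<open>c\<close> is unknown,
but near both ends it is a power of \<open>f\<close>. So a long piece of orbit, from near \<open>1\<close> to near \<open>0\<close>, does
not see \<open>c\<close> except through powers of \<open>f\<close>, and composing a high power of \<open>c g c\<inverse>\<close> with powers of \<open>f\<close> on
both sides, all in \<open>H\<close>, gives back \<open>p\<close> on \<open>J\<close>.

Consequently \<open>H\<close> contains every \<open>k \<in> G\<close> that is the identity near both ends: some \<open>c k c\<inverse>\<close> lies in
\<open>H\<close>, and replacing \<open>c\<close> by an \<open>h \<in> H\<close> with the same values on the support of \<open>k\<close> undoes the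
conjugation. Finally \<open>g\<inverse> c g c\<inverse>\<close> is always such a \<open>k\<close>, since germs that are powers of \<open>f\<close> commute, so
\<open>c g c\<inverse> \<in> H\<close> implies \<open>g \<in> H\<close>.

For the piecewise linear groups the slopes are the powers of one number \<open>l\<close>, so near an end an
element is determined by an integer, and it suffices to exhibit one map \<open>f\<close> with slope \<open>l\<close> at \<open>0\<close> and
\<open>1/l\<close> at \<open>1\<close>. The choice \<open>l = 1/n\<close> gives the Higman--Thompson groups and \<open>l = \<tau>\<close> the golden ratio one.
\<close>

section \<open>Groups of increasing homeomorphisms of the unit interval\<close>

text \<open>The product is required to be composition only on \<open>[0,1]\<close>, because elements of \<open>BijGroup\<close> carry
  default values elsewhere.\<close>

locale increasing_homeo_group = group G for G :: "(real \<Rightarrow> real) monoid" (structure) +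
  assumes mult_apply: "\<lbrakk>g \<in> carrier G; h \<in> carrier G; x \<in> {0..1}\<rbrakk> \<Longrightarrow> (g \<otimes> h) x = g (h x)"
    and one_apply: "x \<in> {0..1} \<Longrightarrow> \<one> x = x"
    and eq_if_eq_on_unit: "\<lbrakk>g \<in> carrier G; h \<in> carrier G; \<And>x. x \<in> {0..1} \<Longrightarrow> g x = h x\<rbrakk> \<Longrightarrow> g = h"
    and maps_unit: "\<lbrakk>g \<in> carrier G; x \<in> {0..1}\<rbrakk> \<Longrightarrow> g x \<in> {0..1}"
    and increasing: "g \<in> carrier G \<Longrightarrow> strict_mono_on {0..1} g"
    and continuous: "g \<in> carrier G \<Longrightarrow> continuous_on {0..1} g"
begin

lemma inv_apply:
  assumes "g \<in> carrier G" "x \<in> {0..1}"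
  shows "(inv g) (g x) = x" and "g ((inv g) x) = x"
  using assms mult_apply[of "inv g" g x] mult_apply[of g "inv g" x] by (simp_all add: one_apply)

lemma cancel:
  assumes "c \<in> carrier G" "y \<in> carrier G"
  shows "inv c \<otimes> (c \<otimes> y) = y" and "c \<otimes> (inv c \<otimes> y) = y"
  using assms by (simp_all flip: m_assoc)

lemma apply_less_iff:
  assumes "g \<in> carrier G" "x \<in> {0..1}" "y \<in> {0..1}"
  shows "g x < g y \<longleftrightarrow> x < y"
  using strict_mono_on_less[OF increasing[OF assms(1)] assms(2,3)] .

lemma apply_le_iff:
  assumes "g \<in> carrier G" "x \<in> {0..1}" "y \<in> {0..1}"
  shows "g x \<le> g y \<longleftrightarrow> x \<le> y"
  using strict_mono_on_less_eq[OF increasing[OF assms(1)] assms(2,3)] .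

lemma apply_0:
  assumes "g \<in> carrier G" shows "g 0 = 0"
proof -
  have "(inv g) 0 \<in> {0..1}" using maps_unit[of "inv g" 0] assms by simp
  then have "g 0 \<le> g ((inv g) 0)" using apply_le_iff[OF assms, of 0 "(inv g) 0"] by simp
  then show ?thesis using assms inv_apply(2)[of g 0] maps_unit[of g 0] by auto
qed

lemma apply_1:
  assumes "g \<in> carrier G" shows "g 1 = 1"
proof -
  have "(inv g) 1 \<in> {0..1}" using maps_unit[of "inv g" 1] assms by simp
  then have "g 1 \<ge> g ((inv g) 1)" using apply_le_iff[OF assms, of "(inv g) 1" 1] by simp
  then show ?thesis using assms inv_apply(2)[of g 1] maps_unit[of g 1] by auto
qed

lemma maps_interior:
  assumes "g \<in> carrier G" "x \<in> {0<..<1}" shows "g x \<in> {0<..<1}"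
  using assms apply_less_iff[of g 0 x] apply_less_iff[of g x 1] apply_0[of g] apply_1[of g] by auto

text \<open>Germs are compared along the filter of points of \<open>(0,1)\<close> that converge to \<open>z\<close>, so that \<open>z = 0\<close> and
  \<open>z = 1\<close> are treated by the same proofs.\<close>

definition same_germ :: "real \<Rightarrow> (real \<Rightarrow> real) \<Rightarrow> (real \<Rightarrow> real) \<Rightarrow> bool" where
  "same_germ z g h \<longleftrightarrow> (\<forall>\<^sub>F x in at z within {0<..<1}. g x = h x)"

lemma eventually_interior: "\<forall>\<^sub>F x in at z within {0<..<1::real}. x \<in> {0<..<1}"
  by (simp add: eventually_at_filter)

text \<open>This is what makes germs at an endpoint composable: group elements fix \<open>0\<close> and \<open>1\<close> and preserve
  the open interval.\<close>

lemma filterlim_endpoint: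
  assumes g: "g \<in> carrier G" and z: "z \<in> {0, 1}"
  shows "filterlim g (at z within {0<..<1}) (at z within {0<..<1})"
  unfolding filterlim_at
proof
  have "g z = z" using z apply_0[OF g] apply_1[OF g] by auto
  moreover have "(g \<longlongrightarrow> g z) (at z within {0..1})"
    using continuous[OF g] z by (auto simp: continuous_on_def)
  ultimately show "(g \<longlongrightarrow> z) (at z within {0<..<1})"
    by (metis tendsto_within_subset greaterThanLessThan_subseteq_atLeastAtMost_iff order_refl)
  show "\<forall>\<^sub>F x in at z within {0<..<1}. g x \<in> {0<..<1} \<and> g x \<noteq> z"
    using eventually_interior 
  proof eventually_elim
    case (elim x)
    then show ?case using maps_interior[OF g, of x] z by auto
  qed
qed

lemma same_germ_mult:
  assumes G: "g \<in> carrier G" "g' \<in> carrier G" "h \<in> carrier G" "h' \<in> carrier G" and z: "z \<in> {0, 1}"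
    and g: "same_germ z g g'" and h: "same_germ z h h'"
  shows "same_germ z (g \<otimes> h) (g' \<otimes> h')"
proof -
  have "\<forall>\<^sub>F x in at z within {0<..<1}. g (h x) = g' (h x)"
    using filterlim_endpoint[OF G(3) z] g unfolding same_germ_def filterlim_iff by blast
  with h[unfolded same_germ_def] eventually_interior[of z] show ?thesis
    unfolding same_germ_def by eventually_elim (use G in \<open>simp add: mult_apply\<close>)
qed

lemma same_germ_inv:
  assumes G: "g \<in> carrier G" "g' \<in> carrier G" and z: "z \<in> {0, 1}" and g: "same_germ z g g'"
  shows "same_germ z (inv g) (inv g')"
proof -
  have "\<forall>\<^sub>F x in at z within {0<..<1}. g ((inv g) x) = g' ((inv g) x)"
    using filterlim_endpoint[of "inv g", OF _ z] G g unfolding same_germ_def filterlim_iff by blast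
  with eventually_interior[of z] show ?thesis
    unfolding same_germ_def
  proof eventually_elim
    case (elim x)
    then have "x = g' ((inv g) x)" using G inv_apply(2)[of g x] by simp
    then show ?case using elim G inv_apply(1)[of g' "(inv g) x"] maps_unit[of "inv g" x] by simp
  qed
qed

lemma same_germ_0D:
  assumes "same_germ 0 g h"
  shows "\<exists>a\<in>{0<..<1}. \<forall>x\<in>{0<..a}. g x = h x"
proof -
  obtain d where d: "d > 0" "\<And>x. \<lbrakk>x \<in> {0<..<1}; x \<noteq> 0; dist x 0 < d\<rbrakk> \<Longrightarrow> g x = h x"
    using assms unfolding same_germ_def eventually_at by blast
  show ?thesis
    by (rule bexI[of _ "min (d/2) (1/2)"]) (use d in \<open>auto simp: dist_real_def\<close>)
qed

lemma same_germ_1D: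
  assumes "same_germ 1 g h"
  shows "\<exists>b\<in>{0<..<1}. \<forall>x\<in>{b..<1}. g x = h x"
proof -
  obtain d where d: "d > 0" "\<And>x. \<lbrakk>x \<in> {0<..<1}; x \<noteq> 1; dist x 1 < d\<rbrakk> \<Longrightarrow> g x = h x"
    using assms unfolding same_germ_def eventually_at by blast
  show ?thesis
    by (rule bexI[of _ "max (1 - d/2) (1/2)"]) (use d in \<open>auto simp: dist_real_def\<close>)
qed

end

section \<open>Germs at the endpoints that are powers of one contraction\<close>

locale cyclic_germs = increasing_homeo_group +
  fixes f
  assumes f_closed: "f \<in> carrier G"
    and f_less: "x \<in> {0<..<1} \<Longrightarrow> f x < x"
    and germ_power: "\<lbrakk>g \<in> carrier G; z \<in> {0, 1}\<rbrakk> \<Longrightarrow> \<exists>k::int. same_germ z g (f [^] k)"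
begin

abbreviation F :: "int \<Rightarrow> real \<Rightarrow> real" where "F k \<equiv> f [^] k"

lemma F_closed [simp]: "F k \<in> carrier G"
  using f_closed by simp

lemma F_add: "x \<in> {0..1} \<Longrightarrow> F (k + l) x = F k (F l x)"
  using f_closed by (simp add: int_pow_mult mult_apply)

lemma F_0: "x \<in> {0..1} \<Longrightarrow> F 0 x = x"
  by (simp add: one_apply)

lemma F_interior: "x \<in> {0<..<1} \<Longrightarrow> F k x \<in> {0<..<1}"
  by (rule maps_interior[OF F_closed])

lemma F_antimono:
  assumes "k \<le> l" "x \<in> {0<..<1}" shows "F l x \<le> F k x"
  using assms(1)
proof (induction l rule: int_ge_induct)
  case (step i)
  have "F (i + 1) x = f (F i x)"
    using F_add[of x 1 i] assms(2) f_closed by (simp add: add.commute)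
  also have "\<dots> \<le> F i x" using f_less[OF F_interior[OF assms(2)]] by (simp add: less_imp_le)
  finally show ?case using step by simp
qed simp

text \<open>Otherwise the infimum \<open>y\<close> of the orbit lies in \<open>(0,1)\<close>. Its preimage under \<open>f\<close> is larger than \<open>y\<close>,
  so some orbit point lies below that preimage, and the next one lies below \<open>y\<close>.\<close>

lemma F_eventually_small:
  assumes x: "x \<in> {0<..<1}" and e: "0 < e"
  obtains K where "\<And>k. K \<le> k \<Longrightarrow> F k x < e"
proof -
  have "\<exists>K. F K x < e"
  proof (rule ccontr)
    assume "\<nexists>K. F K x < e"
    then have ge: "\<And>K. e \<le> F K x" by (simp add: not_less)
    define y where "y = (INF K. F K x)"
    have bdd: "bdd_below (range (\<lambda>K. F K x))" using ge by (intro bdd_belowI2) 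
    have "e \<le> y" unfolding y_def using ge by (intro cINF_greatest) auto
    moreover have y_le: "y \<le> F K x" for K unfolding y_def using bdd by (intro cINF_lower) auto
    ultimately have y: "y \<in> {0<..<1}" using y_le[of 0] x e F_0[of x] by auto
    define z where "z = (inv f) y"
    have z: "z \<in> {0<..<1}" "f z = y"
      unfolding z_def using y f_closed inv_apply(2)[of f y] maps_interior[of "inv f" y] by auto
    then have "y < z" using f_less[of z] by simp
    then obtain K where "F K x < z" unfolding y_def using bdd by (auto simp: cINF_less_iff)
    then have "f (F K x) < y"
      using apply_less_iff[OF f_closed, of "F K x" z] z F_interior[OF x, of K] by auto
    moreover have "f (F K x) = F (1 + K) x" using F_add[of x 1 K] x f_closed by simp
    ultimately show False using y_le[of "1 + K"] by simp
  qed
  then obtain K where "F K x < e" ..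
  then show thesis using F_antimono[OF _ x] by (intro that[of K]) (meson le_less_trans)
qed

lemma F_eventually_large:
  assumes x: "x \<in> {0<..<1}" and e: "e < 1"
  obtains K where "\<And>k. K \<le> k \<Longrightarrow> e < F (- k) x"
proof -
  define e' where "e' = max e (1/2)"
  have e': "e' \<in> {0<..<1}" "e \<le> e'" unfolding e'_def using e by auto
  obtain K where K: "\<And>k. K \<le> k \<Longrightarrow> F k e' < x" using F_eventually_small[OF e'(1)] x by auto
  show thesis
  proof (rule that[of K])
    fix k assume "K \<le> k"
    then have "F (-k) (F k e') < F (-k) x"
      using K x F_interior[OF e'(1), of k] apply_less_iff[OF F_closed, of "F k e'" x "-k"] by simp
    moreover have "F (-k) (F k e') = e'" using F_add[of e' "-k" k] F_0[of e'] e' by simp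
    ultimately show "e < F (-k) x" using e' by simp
  qed
qed

lemma pow_apply_Suc:
  assumes "g \<in> carrier G" "x \<in> {0..1}"
  shows "(g [^] Suc n) x = g ((g [^] n) x)"
  using assms mult_apply[of g "g [^] n" x] nat_pow_Suc2[OF assms(1), of n] by simp

lemma pow_apply_add:
  assumes "g \<in> carrier G" "x \<in> {0..1}"
  shows "(g [^] (m + n :: nat)) x = (g [^] m) ((g [^] n) x)"
  using assms mult_apply[of "g [^] m" "g [^] n" x] by (simp add: nat_pow_mult)

lemma conj_pow:
  assumes "g \<in> carrier G" "c \<in> carrier G"
  shows "(c \<otimes> g \<otimes> inv c) [^] (k::int) = c \<otimes> g [^] k \<otimes> inv c"
proof -
  have "(\<lambda>y. c \<otimes> y \<otimes> inv c) \<in> hom G G"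
    using assms(2) by (auto simp: hom_def m_assoc cancel)
  from hom_int_pow[OF this assms(1) is_group is_group] show ?thesis by simp
qed

lemma conj_apply:
  assumes "g \<in> carrier G" "c \<in> carrier G" "x \<in> {0..1}"
  shows "(c \<otimes> g \<otimes> inv c) (c x) = c (g x)"
proof -
  have "(c \<otimes> g \<otimes> inv c) (c x) = (c \<otimes> g) ((inv c) (c x))"
    using assms maps_unit[OF assms(2,3)] by (intro mult_apply) auto
  then show ?thesis using assms by (simp add: inv_apply(1) mult_apply)
qed

end

section \<open>Subgroups that meet every conjugacy class\<close>

locale conjugacy_dense_subgroup = cyclic_germs +
  fixes H
  assumes H: "subgroup H G" and f_mem: "f \<in> H"
    and meets: "g \<in> carrier G \<Longrightarrow> \<exists>c\<in>carrier G. c \<otimes> g \<otimes> inv c \<in> H"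
begin

lemma F_mem: "F k \<in> H"
  by (rule subgroup_int_pow_closed[OF H f_mem])

lemma H_closed: "h \<in> H \<Longrightarrow> h \<in> carrier G"
  by (rule subgroup.mem_carrier[OF H])

lemma H_mult: "h \<in> H \<Longrightarrow> h' \<in> H \<Longrightarrow> h \<otimes> h' \<in> H"
  by (rule subgroup.m_closed[OF H])

text \<open>The heart of the argument. With \<open>g = f\<^sup>m p\<close> one has \<open>g\<^sup>n = f\<^bsup>mn\<^esup> p\<close> on \<open>J = [j0,j1]\<close> for \<open>n \<ge> 1\<close>, and \<open>g\<close>
  equals \<open>f\<^sup>M\<close> to the right of \<open>J\<close>, where \<open>M = m + s\<close> and \<open>f\<^sup>s\<close> is the germ of \<open>p\<close> at \<open>1\<close>. Hence
  \<open>g\<^bsup>n+i\<^esup>\<close> carries \<open>f\<^bsup>-Mi\<^esup> x\<close> to \<open>f\<^bsup>mn\<^esup> (p x)\<close> for \<open>x \<in> J\<close>. For large \<open>i\<close> and \<open>n\<close> these two points are so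
  close to \<open>1\<close> and \<open>0\<close> that the conjugator \<open>c\<close> acts on them as \<open>f\<^sup>v\<close> and \<open>f\<^sup>u\<close>. So the same power of
  \<open>c g c\<inverse>\<close> carries \<open>f\<^bsup>v-Mi\<^esup> x\<close> to \<open>f\<^bsup>u+mn\<^esup> (p x)\<close>, and \<open>c\<close> has disappeared.\<close>

lemma agrees_on_compact_normalized:
  assumes p: "p \<in> carrier G" and p0: "same_germ 0 p \<one>" and cd: "c \<in> {0<..<1}" "d \<in> {0<..<1}"
  shows "\<exists>h\<in>H. \<forall>x\<in>{c..d}. h x = p x"
proof -
  obtain s where s: "same_germ 1 p (F s)" using germ_power[OF p, of 1] by auto
  obtain a where a: "a \<in> {0<..<1}" "\<forall>x\<in>{0<..a}. p x = \<one> x"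
    using same_germ_0D[OF p0] ..
  obtain b where b: "b \<in> {0<..<1}" "\<forall>x\<in>{b..<1}. p x = F s x"
    using same_germ_1D[OF s] ..
  define j0 where "j0 = min a c"
  define j1 where "j1 = max b d"
  have j: "j0 \<in> {0<..<1}" "j1 \<in> {0<..<1}" "j0 \<le> a" "b \<le> j1" "{c..d} \<subseteq> {j0..j1}"
    unfolding j0_def j1_def using a b cd by auto
  have p_low: "p x = x" if "0 < x" "x \<le> j0" for x
    using a(2) that j by (simp add: one_apply)
  have p_high: "p x = F s x" if "j1 \<le> x" "x < 1" for x
    using b(2) that j by simp
  obtain K where K: "\<And>k. K \<le> k \<Longrightarrow> F k (p j1) < j0"
    using F_eventually_small[OF maps_interior[OF p j(2)], of j0] j(1) by (metis greaterThanLessThan_iff)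
  \<comment> \<open>The entry \<open>1 - s\<close> makes \<open>M = m + s\<close> positive, so that \<open>g\<close> moves points to the left near \<open>1\<close> as well.\<close>
  define m where "m = max K (max 1 (1 - s))"
  define M where "M = m + s"
  have m: "1 \<le> m" "1 \<le> M" "F m (p j1) < j0"
    unfolding m_def M_def using K by auto
  define g where "g = F m \<otimes> p"
  have gG: "g \<in> carrier G" unfolding g_def using p by simp
  have g_apply: "g x = F m (p x)" if "x \<in> {0..1}" for x
    unfolding g_def using that p by (simp add: mult_apply)
  have g_J: "0 < g x" "g x \<le> j0" if "0 < x" "x \<le> j1" for x
  proof -
    have x: "x \<in> {0<..<1}" using that j by auto
    then show "0 < g x" using maps_interior[OF gG] by auto
    have "g x \<le> g j1" using x that j apply_le_iff[OF gG, of x j1] by simp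
    also have "\<dots> < j0" using m j g_apply[of j1] by simp
    finally show "g x \<le> j0" by simp
  qed
  have g_low: "g x = F m x" if "0 < x" "x \<le> j0" for x
    using g_apply[of x] that p_low j by simp
  have g_pow: "(g [^] Suc n) x = F (m * int (Suc n)) (p x)" if "0 < x" "x \<le> j1" for x n
  proof (induction n)
    case 0
    then show ?case using g_apply[of x] that j gG by simp
  next
    case (Suc n)
    have px: "p x \<in> {0<..<1}" using maps_interior[OF p, of x] that j by auto
    have "(g [^] Suc (Suc n)) x = g (F (m * int (Suc n)) (p x))"
      using pow_apply_Suc[OF gG, of x "Suc n"] Suc that j by simp
    also have "\<dots> = F m (F (m * int (Suc n)) (p x))"
    proof (rule g_low)
      show "0 < F (m * int (Suc n)) (p x)" using F_interior[OF px] by simp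
      have "F (m * int (Suc n)) (p x) \<le> F m (p x)"
        using F_antimono[OF _ px, of m "m * int (Suc n)"] m by simp
      also have "\<dots> \<le> j0" using g_J[OF that] g_apply[of x] that j by simp
      finally show "F (m * int (Suc n)) (p x) \<le> j0" .
    qed
    also have "\<dots> = F (m * int (Suc (Suc n))) (p x)"
      using F_add[of "p x" m "m * int (Suc n)"] px by (simp add: algebra_simps)
    finally show ?case .
  qed
  \<comment> \<open>One backward step by \<open>f\<^sup>M\<close> from \<open>J\<close> leaves \<open>J\<close>, so \<open>g\<close> retraces the whole backward orbit.\<close>
  have j1_le: "j1 \<le> F (- M) j0"
  proof -
    have "F M j1 = g j1"
      using F_add[of j1 m s] p_high[of j1] g_apply[of j1] j by (simp add: M_def)
    also have "\<dots> \<le> j0" using g_J[of j1] j by simp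
    finally have "F (- M) (F M j1) \<le> F (- M) j0"
      using j F_interior[OF j(2), of M] apply_le_iff[OF F_closed, of "F M j1" j0 "- M"] by simp
    then show ?thesis using F_add[of j1 "- M" M] F_0[of j1] j by simp
  qed
  have g_back: "(g [^] i) (F (- M * int i) x) = x" if x: "x \<in> {j0..j1}" for x i
  proof (induction i)
    case 0
    then show ?case using x j by (simp add: one_apply)
  next
    case (Suc i)
    have x01: "x \<in> {0<..<1}" using x j by auto
    define y where "y = F (- M * int (Suc i)) x"
    have y01: "y \<in> {0<..<1}" unfolding y_def using F_interior[OF x01] .
    have "F (- M) j0 \<le> F (- M) x" using x x01 j apply_le_iff[OF F_closed, of j0 x "- M"] by simp
    also have "\<dots> \<le> y" unfolding y_def using m by (intro F_antimono[OF _ x01]) simp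
    finally have "j1 \<le> y" using j1_le by simp
    then have "g y = F M y"
      using g_apply[of y] p_high[of y] y01 F_add[of y m s] by (simp add: M_def)
    also have "\<dots> = F (- M * int i) x"
      unfolding y_def using F_add[of x M "- M * int (Suc i)"] x01 by (simp add: algebra_simps)
    finally have "g y = F (- M * int i) x" .
    moreover have "(g [^] Suc i) y = (g [^] i) (g y)"
      using pow_apply_add[OF gG, of y i 1] y01 gG by simp
    ultimately show ?case using Suc unfolding y_def by simp
  qed
  obtain c where c: "c \<in> carrier G" "c \<otimes> g \<otimes> inv c \<in> H" using meets[OF gG] by blast
  obtain u where u: "same_germ 0 c (F u)" using germ_power[OF c(1), of 0] by auto
  obtain e0 where e0: "e0 \<in> {0<..<1}" "\<forall>x\<in>{0<..e0}. c x = F u x"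
    using same_germ_0D[OF u] ..
  obtain v where v: "same_germ 1 c (F v)" using germ_power[OF c(1), of 1] by auto
  obtain e1 where e1: "e1 \<in> {0<..<1}" "\<forall>x\<in>{e1..<1}. c x = F v x"
    using same_germ_1D[OF v] ..
  obtain N where N: "\<And>k. N \<le> k \<Longrightarrow> F k (p j1) < e0"
    using F_eventually_small[OF maps_interior[OF p j(2)], of e0] e0(1) by (metis greaterThanLessThan_iff)
  obtain I where I: "\<And>k. I \<le> k \<Longrightarrow> e1 < F (- k) j0"
    using F_eventually_large[OF j(1), of e1] e1(1) by (metis greaterThanLessThan_iff)
  define n where "n = nat N"
  define i where "i = nat I"
  define k where "k = (c \<otimes> g \<otimes> inv c) [^] (Suc n + i)"
  have mn: "N \<le> m * int (Suc n)" and Mi: "I \<le> M * int i"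
  proof -
    have "int (Suc n) \<le> m * int (Suc n)" using m by simp
    then show "N \<le> m * int (Suc n)" unfolding n_def by linarith
    have "int i \<le> M * int i" using m by (simp add: mult_le_cancel_right1)
    then show "I \<le> M * int i" unfolding i_def by linarith
  qed
  have k_eq: "k = c \<otimes> g [^] (Suc n + i) \<otimes> inv c"
    unfolding k_def using conj_pow[OF gG c(1), of "int (Suc n + i)"] by (simp only: int_pow_int)
  have kH: "k \<in> H"
    unfolding k_def using subgroup_int_pow_closed[OF H c(2), of "int (Suc n + i)"] by (simp only: int_pow_int)
  define h where "h = F (- (u + m * int (Suc n))) \<otimes> k \<otimes> F (v - M * int i)"
  have "h \<in> H" unfolding h_def by (intro H_mult F_mem kH)
  moreover have "h x = p x" if x: "x \<in> {j0..j1}" for x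
  proof -
    have x01: "x \<in> {0<..<1}" using x j by auto
    define y where "y = F (- M * int i) x"
    have y01: "y \<in> {0<..<1}" unfolding y_def using F_interior[OF x01] .
    have px: "p x \<in> {0<..<1}" using maps_interior[OF p x01] .
    have "e1 < F (- M * int i) j0" using I[OF Mi] by simp
    also have "\<dots> \<le> y" unfolding y_def using x x01 j apply_le_iff[OF F_closed, of j0 x "- M * int i"] by simp
    finally have cy: "c y = F v y" using e1(2) y01 by simp
    have "F (v - M * int i) x = F v y"
      unfolding y_def using F_add[of x v "- M * int i"] x01 by simp
    moreover note cy[symmetric]
    moreover have "k (c y) = c ((g [^] (Suc n + i)) y)"
      unfolding k_eq using conj_apply[OF _ c(1)] gG y01 by simp
    moreover have "(g [^] (Suc n + i)) y = F (m * int (Suc n)) (p x)"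
      using pow_apply_add[OF gG, of y "Suc n" i] y01 g_back[OF x, of i] g_pow[of x n] x x01
      unfolding y_def by simp
    moreover have "c (F (m * int (Suc n)) (p x)) = F u (F (m * int (Suc n)) (p x))"
    proof (rule e0(2)[rule_format])
      have pos: "0 < F (m * int (Suc n)) (p x)" using F_interior[OF px] by simp
      have "p x \<le> p j1" using x x01 j apply_le_iff[OF p, of x j1] by simp
      then have "F (m * int (Suc n)) (p x) \<le> F (m * int (Suc n)) (p j1)"
        using px maps_interior[OF p j(2)] apply_le_iff[OF F_closed, of "p x" "p j1" "m * int (Suc n)"] by simp
      also have "\<dots> < e0" using N[OF mn] .
      finally have "F (m * int (Suc n)) (p x) \<le> e0" by simp
      with pos show "F (m * int (Suc n)) (p x) \<in> {0<..e0}" by simp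
    qed
    moreover have "F u (F (m * int (Suc n)) (p x)) = F (u + m * int (Suc n)) (p x)"
      using F_add[of "p x" u "m * int (Suc n)"] px by simp
    moreover have "F (- (u + m * int (Suc n))) (F (u + m * int (Suc n)) (p x)) = p x"
      using F_add[of "p x" "- (u + m * int (Suc n))" "u + m * int (Suc n)"] px F_0[of "p x"] by simp
    ultimately show ?thesis
      unfolding h_def using H_closed[OF kH] x01 F_interior[OF x01, of "v - M * int i"]
      by (simp add: mult_apply)
  qed
  ultimately show ?thesis using j(5) by blast
qed

lemma agrees_on_compact:
  assumes p: "p \<in> carrier G" and cd: "c \<in> {0<..<1}" "d \<in> {0<..<1}"
  shows "\<exists>h\<in>H. \<forall>x\<in>{c..d}. h x = p x"
proof -
  obtain r where r: "same_germ 0 p (F r)" using germ_power[OF p, of 0] by auto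
  have "same_germ 0 (F (- r) \<otimes> p) (F (- r) \<otimes> F r)"
    using r p by (intro same_germ_mult) (auto simp: same_germ_def)
  then have "same_germ 0 (F (- r) \<otimes> p) \<one>"
    using f_closed by (simp flip: int_pow_mult)
  then obtain h where h: "h \<in> H" "\<And>x. x \<in> {c..d} \<Longrightarrow> h x = (F (- r) \<otimes> p) x"
    using agrees_on_compact_normalized[of "F (- r) \<otimes> p" c d] p cd by auto
  have "(F r \<otimes> h) x = p x" if "x \<in> {c..d}" for x
  proof -
    have "x \<in> {0..1}" using that cd by auto
    then show ?thesis
      using h that p H_closed F_add[of "p x" r "- r"] F_0[of "p x"] maps_unit[of p x] by (simp add: mult_apply)
  qed
  then show ?thesis using H_mult[OF F_mem h(1)] by blast
qed

text \<open>Conjugation of \<open>k\<close> by \<open>c\<close> depends only on the values of \<open>c\<close> on an interval that contains the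
  support of \<open>k\<close>, and there \<open>c\<close> can be replaced by an element of \<open>H\<close>.\<close>

lemma compactly_supported_mem:
  assumes k: "k \<in> carrier G" and k0: "same_germ 0 k \<one>" and k1: "same_germ 1 k \<one>"
  shows "k \<in> H"
proof -
  obtain a where a: "a \<in> {0<..<1}" "\<forall>x\<in>{0<..a}. k x = \<one> x"
    using same_germ_0D[OF k0] ..
  obtain b where b: "b \<in> {0<..<1}" "\<forall>x\<in>{b..<1}. k x = \<one> x"
    using same_germ_1D[OF k1] ..
  have fix_out: "k x = x" if "x \<in> {0..1}" "x \<notin> {a<..<b}" for x
    using that a b apply_0[OF k] apply_1[OF k]
    by (cases "x = 0 \<or> x = 1") (auto simp: one_apply not_less)
  obtain c where c: "c \<in> carrier G" "c \<otimes> k \<otimes> inv c \<in> H" using meets[OF k] by blast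
  obtain h where h: "h \<in> H" "\<And>x. x \<in> {a..b} \<Longrightarrow> h x = c x"
    using agrees_on_compact[of c a b] c a b by auto
  note hG = H_closed[OF h(1)]
  have "h \<otimes> k = (c \<otimes> k \<otimes> inv c) \<otimes> h"
  proof (rule eq_if_eq_on_unit)
    fix x :: real assume x: "x \<in> {0..1}"
    show "(h \<otimes> k) x = ((c \<otimes> k \<otimes> inv c) \<otimes> h) x"
    proof (cases "x \<in> {a<..<b}")
      case True
      have "k a < k x" "k x < k b" using True a b x apply_less_iff[OF k, of a x] apply_less_iff[OF k, of x b] by simp_all
      then have "k x \<in> {a..b}" using fix_out[of a] fix_out[of b] a b by auto
      then have "h (k x) = c (k x)" using h by simp
      also have "\<dots> = (c \<otimes> k \<otimes> inv c) (c x)" using conj_apply[OF k c(1) x] by simp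
      also have "c x = h x" using True h by simp
      finally show ?thesis using x k c hG by (simp add: mult_apply)
    next
      case False
      define y where "y = (inv c) (h x)"
      have hx: "h x \<in> {0..1}" using maps_unit[OF hG x] .
      have y: "y \<in> {0..1}" "c y = h x"
        unfolding y_def using c hx inv_apply(2)[of c "h x"] maps_unit[of "inv c" "h x"] by auto
      have "y \<notin> {a<..<b}"
      proof
        assume "y \<in> {a<..<b}"
        then have "h y = h x" using h y by simp
        then have "x = y" using inv_apply(1)[OF hG] x y by metis
        then show False using False \<open>y \<in> {a<..<b}\<close> by simp
      qed
      then have "c (k y) = h x" using fix_out y by simp
      moreover have "(c \<otimes> k \<otimes> inv c) (h x) = c (k y)" using conj_apply[OF k c(1) y(1)] y by simp
      ultimately show ?thesis using x k c hG fix_out[OF x False] by (simp add: mult_apply)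
    qed
  qed (use k c hG in auto)
  then have "k = inv h \<otimes> ((c \<otimes> k \<otimes> inv c) \<otimes> h)"
    using cancel(1)[OF hG k] by simp
  then show ?thesis
    using H_mult[OF subgroup.m_inv_closed[OF H h(1)] H_mult[OF c(2) h(1)]] by simp
qed

text \<open>If \<open>c g c\<inverse> \<in> H\<close>, then \<open>g\<inverse> c g c\<inverse>\<close> has trivial germs at both ends, because the germs of \<open>g\<close> and \<open>c\<close>
  at an end are powers of the same element and commute. So it lies in \<open>H\<close>, and with it \<open>g\<close>.\<close>

lemma subgroup_eq_carrier: "H = carrier G"
proof
  show "carrier G \<subseteq> H"
  proof
    fix g assume g: "g \<in> carrier G"
    obtain c where c: "c \<in> carrier G" "c \<otimes> g \<otimes> inv c \<in> H" using meets[OF g] by blast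
    define k where "k = inv g \<otimes> (c \<otimes> g \<otimes> inv c)"
    have k: "k \<in> carrier G" unfolding k_def using g c by simp
    have "same_germ z k \<one>" if z: "z \<in> {0, 1}" for z
    proof -
      obtain r where r: "same_germ z g (F r)" using germ_power[OF g z] ..
      obtain u where u: "same_germ z c (F u)" using germ_power[OF c(1) z] ..
      have "same_germ z k (inv (F r) \<otimes> (F u \<otimes> F r \<otimes> inv (F u)))"
        unfolding k_def using g c z r u by (intro same_germ_mult same_germ_inv) auto
      moreover have "F u \<otimes> F r = F r \<otimes> F u"
        using int_pow_mult[OF f_closed, of u r] int_pow_mult[OF f_closed, of r u] by (simp add: add.commute)
      then have "inv (F r) \<otimes> (F u \<otimes> F r \<otimes> inv (F u)) = \<one>"
        by (simp add: m_assoc)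
      ultimately show ?thesis by (simp only:)
    qed
    then have "k \<in> H" using k by (intro compactly_supported_mem) auto
    moreover have "g = (c \<otimes> g \<otimes> inv c) \<otimes> inv k"
      unfolding k_def using g c by (simp add: inv_mult_group m_assoc cancel)
    ultimately show "g \<in> H"
      using H_mult[OF c(2) subgroup.m_inv_closed[OF H]] by metis
  qed
qed (use H_closed in blast)

end

context cyclic_germs
begin

text \<open>Allows \<open>f\<close> to be replaced by whichever of its conjugates the subgroup contains.\<close>

lemma cyclic_germs_conj:
  assumes c: "c \<in> carrier G" shows "cyclic_germs G (c \<otimes> f \<otimes> inv c)"
proof unfold_locales
  show "c \<otimes> f \<otimes> inv c \<in> carrier G" using c f_closed by simp
  show "(c \<otimes> f \<otimes> inv c) x < x" if x: "x \<in> {0<..<1}" for x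
  proof -
    define y where "y = (inv c) x"
    have y: "y \<in> {0<..<1}" "c y = x"
      unfolding y_def using c x inv_apply(2)[of c x] maps_interior[of "inv c" x] by auto
    have "(c \<otimes> f \<otimes> inv c) x = c (f y)" using conj_apply[OF f_closed c, of y] y by simp
    also have "\<dots> < c y"
      using f_less[OF y(1)] y(1) maps_interior[OF f_closed y(1)] apply_less_iff[OF c, of "f y" y] by simp
    finally show ?thesis using y by simp
  qed
  show "\<exists>k::int. same_germ z g ((c \<otimes> f \<otimes> inv c) [^] k)" if g: "g \<in> carrier G" and z: "z \<in> {0, 1}" for g z
  proof -
    obtain k where k: "same_germ z (inv c \<otimes> g \<otimes> c) (F k)"
      using germ_power[of "inv c \<otimes> g \<otimes> c" z] c g z by auto
    have "same_germ z (c \<otimes> (inv c \<otimes> g \<otimes> c) \<otimes> inv c) (c \<otimes> F k \<otimes> inv c)"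
      using g c z k by (intro same_germ_mult) (auto simp: same_germ_def)
    moreover have "c \<otimes> (inv c \<otimes> g \<otimes> c) \<otimes> inv c = g"
      using g c by (simp add: m_assoc cancel)
    ultimately have "same_germ z g (c \<otimes> F k \<otimes> inv c)" by (simp only:)
    then show ?thesis unfolding conj_pow[OF f_closed c] by blast
  qed
qed

text \<open>The conjugate of \<open>f\<close> chosen by \<open>\<kappa>\<close> lies in the generated subgroup and takes over the role of
  \<open>f\<close>.\<close>

theorem invariably_generated: "invariably_generated G"
  unfolding invariably_generated_def
proof (intro conjI ballI)
  fix \<kappa> assume \<kappa>: "\<kappa> \<in> carrier G \<rightarrow> carrier G"
  define X where "X = {\<kappa> g \<otimes> g \<otimes> inv (\<kappa> g) |g. g \<in> carrier G}"
  have XG: "X \<subseteq> carrier G" unfolding X_def using \<kappa> by auto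
  have X_mem: "\<kappa> g \<otimes> g \<otimes> inv (\<kappa> g) \<in> generate G X" if "g \<in> carrier G" for g
    unfolding X_def using that by (intro generate.incl) blast
  have \<kappa>f: "\<kappa> f \<in> carrier G" using \<kappa> f_closed by auto
  interpret c: cyclic_germs G "\<kappa> f \<otimes> f \<otimes> inv (\<kappa> f)" using cyclic_germs_conj[OF \<kappa>f] .
  interpret conjugacy_dense_subgroup G "\<kappa> f \<otimes> f \<otimes> inv (\<kappa> f)" "generate G X"
  proof (intro conjugacy_dense_subgroup.intro[OF c.cyclic_germs_axioms] conjugacy_dense_subgroup_axioms.intro)
    show "\<exists>c\<in>carrier G. c \<otimes> g \<otimes> inv c \<in> generate G X" if "g \<in> carrier G" for g
      using X_mem[OF that] \<kappa> that by (intro bexI[of _ "\<kappa> g"]) auto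
  qed (rule generate_is_subgroup[OF XG], rule X_mem[OF f_closed])
  show "generate G X = carrier G" using subgroup_eq_carrier .
qed (rule is_group)

end

section \<open>Affine pieces\<close>

lemma affine_with_slope_subset: "affine_with_slope s f S \<Longrightarrow> T \<subseteq> S \<Longrightarrow> affine_with_slope s f T"
  unfolding affine_with_slope_def by blast

lemma slope_unique:
  assumes "affine_with_slope s f S" "affine_with_slope s' f T" "x \<in> S \<inter> T" "y \<in> S \<inter> T" "x \<noteq> y"
  shows "s = s'"
proof -
  obtain c c' where "\<forall>t\<in>S. f t = s * t + c" "\<forall>t\<in>T. f t = s' * t + c'"
    using assms(1,2) unfolding affine_with_slope_def by blast
  then have "s * x + c = s' * x + c'" "s * y + c = s' * y + c'" using assms(3,4) by force+
  then have "(s - s') * (x - y) = 0" by (simp add: algebra_simps)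
  then show ?thesis using assms(5) by simp
qed

lemma affine_with_slope_compose:
  assumes "affine_with_slope s g S" "affine_with_slope s' f T" "\<And>t. t \<in> S \<Longrightarrow> g t \<in> T"
  shows "affine_with_slope (s' * s) (\<lambda>t. f (g t)) S"
proof -
  obtain c c' where "\<forall>t\<in>S. g t = s * t + c" "\<forall>t\<in>T. f t = s' * t + c'"
    using assms(1,2) unfolding affine_with_slope_def by blast
  then have "\<forall>t\<in>S. f (g t) = s' * s * t + (s' * c + c')"
    using assms(3) by (auto simp: algebra_simps)
  then show ?thesis unfolding affine_with_slope_def by blast
qed

lemma affine_with_slope_inverse:
  assumes "affine_with_slope s f S" "s \<noteq> 0" "\<And>t. t \<in> T \<Longrightarrow> g t \<in> S" "\<And>t. t \<in> T \<Longrightarrow> f (g t) = t"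
  shows "affine_with_slope (inverse s) g T"
proof -
  obtain c where c: "\<forall>t\<in>S. f t = s * t + c" using assms(1) unfolding affine_with_slope_def by blast
  have "g t = inverse s * t + (- c / s)" if "t \<in> T" for t
  proof -
    have "t = s * g t + c" using c assms(3,4) that by metis
    then show ?thesis using assms(2) by (simp add: field_simps)
  qed
  then show ?thesis unfolding affine_with_slope_def by blast
qed

lemma affine_with_slope_cong:
  "(\<And>t. t \<in> S \<Longrightarrow> f t = g t) \<Longrightarrow> affine_with_slope s f S \<longleftrightarrow> affine_with_slope s g S"
  unfolding affine_with_slope_def by auto

lemma finite_isolated:
  fixes B :: "real set"
  assumes "finite B"
  obtains d where "0 < d" "{x<..<x + d} \<inter> B = {}" "{x - d<..<x} \<inter> B = {}"
proof -
  obtain d where "d > 0" "\<forall>b\<in>B. b \<noteq> x \<longrightarrow> d \<le> dist x b"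
    using finite_set_avoid[OF assms] by blast
  then show thesis by (intro that[of d]) (force simp: dist_real_def)+
qed

lemma piecewise_linear_right:
  assumes "piecewise_linear f" "0 \<le> x" "x < 1"
  obtains e s where "0 < e" "x + e \<le> 1" "affine_with_slope s f {x..x + e}"
proof -
  obtain B where B: "finite B"
    "\<And>x y. \<lbrakk>0 \<le> x; x < y; y \<le> 1; {x<..<y} \<inter> B = {}\<rbrakk> \<Longrightarrow> \<exists>s. affine_with_slope s f {x..y}"
    using assms(1) unfolding piecewise_linear_def by blast
  obtain d where d: "0 < d" "{x<..<x + d} \<inter> B = {}" by (rule finite_isolated[OF B(1)])
  define e where "e = min d (1 - x)"
  have e: "0 < e" "x + e \<le> 1" "{x<..<x + e} \<subseteq> {x<..<x + d}" using d assms unfolding e_def by auto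
  then have "\<exists>s. affine_with_slope s f {x..x + e}"
    using d assms by (intro B(2)) auto
  then show thesis using e that by blast
qed

lemma piecewise_linear_left:
  assumes "piecewise_linear f" "0 < x" "x \<le> 1"
  obtains e s where "0 < e" "0 \<le> x - e" "affine_with_slope s f {x - e..x}"
proof -
  obtain B where B: "finite B"
    "\<And>x y. \<lbrakk>0 \<le> x; x < y; y \<le> 1; {x<..<y} \<inter> B = {}\<rbrakk> \<Longrightarrow> \<exists>s. affine_with_slope s f {x..y}"
    using assms(1) unfolding piecewise_linear_def by blast
  obtain d where d: "0 < d" "{x - d<..<x} \<inter> B = {}" by (rule finite_isolated[OF B(1)])
  define e where "e = min d x"
  have e: "0 < e" "0 \<le> x - e" "{x - e<..<x} \<subseteq> {x - d<..<x}" using d assms unfolding e_def by auto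
  then have "\<exists>s. affine_with_slope s f {x - e..x}"
    using d assms by (intro B(2)) auto
  then show thesis using e that by blast
qed

lemma slopesI: "\<lbrakk>affine_with_slope s f {x..y}; 0 \<le> x; x < y; y \<le> 1\<rbrakk> \<Longrightarrow> s \<in> slopes f"
  unfolding slopes_def by blast

lemma not_breakpointI:
  assumes "affine_with_slope s f {a..b}" "a < x" "x < b"
  shows "x \<notin> breakpoints f"
proof -
  have "affine_with_slope s f {x - min (x - a) (b - x)<..<x + min (x - a) (b - x)}"
    by (rule affine_with_slope_subset[OF assms(1)]) auto
  moreover have "min (x - a) (b - x) > 0" using assms by simp
  ultimately show ?thesis unfolding breakpoints_def by blast
qed

lemma not_breakpointE:
  assumes "x \<notin> breakpoints f" "0 < x" "x < 1"
  obtains a b s where "0 \<le> a" "a < x" "x < b" "b \<le> 1" "affine_with_slope s f {a..b}"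
proof -
  obtain e s where e: "e > 0" "affine_with_slope s f {x - e<..<x + e}"
    using assms unfolding breakpoints_def by auto
  define d where "d = min (e / 2) (min x (1 - x))"
  have d: "0 < d" "d < e" "d \<le> x" "d \<le> 1 - x" unfolding d_def using e assms by auto
  have "affine_with_slope s f {x - d..x + d}"
    by (rule affine_with_slope_subset[OF e(2)]) (use d in auto)
  then show thesis using d by (intro that[of "x - d" "x + d" s]) auto
qed

section \<open>Groups of piecewise linear maps\<close>

text \<open>All that is needed of breakpoints and slopes for \<open>PL_group A P\<close> to be a group: \<open>P\<close> is a group of
  positive numbers that acts by multiplication on the additive group \<open>A\<close>.\<close>

locale slope_group =
  fixes A P :: "real set"
  assumes zero_A: "0 \<in> A" and one_A: "1 \<in> A"
    and diff_A: "\<lbrakk>a \<in> A; b \<in> A\<rbrakk> \<Longrightarrow> a - b \<in> A"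
    and one_P: "1 \<in> P"
    and mult_P: "\<lbrakk>s \<in> P; t \<in> P\<rbrakk> \<Longrightarrow> s * t \<in> P"
    and inverse_P: "s \<in> P \<Longrightarrow> inverse s \<in> P"
    and pos_P: "s \<in> P \<Longrightarrow> 0 < s"
    and scale_A: "\<lbrakk>s \<in> P; a \<in> A\<rbrakk> \<Longrightarrow> s * a \<in> A"
begin

lemma add_A: "\<lbrakk>a \<in> A; b \<in> A\<rbrakk> \<Longrightarrow> a + b \<in> A"
  using diff_A[of a "0 - b"] diff_A[OF zero_A, of b] by simp

text \<open>Each affine piece has an intercept in \<open>A\<close>: the first one has intercept \<open>0\<close>, and continuity at a
  breakpoint \<open>b \<in> A\<close> with slopes \<open>s'\<close> and \<open>s\<close> changes the intercept by \<open>s' * b - s * b \<in> A\<close>. The induction is on the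
  number of points of the subdivision \<open>B\<close> to the left of \<open>x\<close>; a point of \<open>B\<close> outside \<open>A\<close> is not a
  breakpoint, so nothing changes there.\<close>

lemma intercept_in_A:
  assumes f0: "f 0 = 0" and pl: "piecewise_linear f" and br: "breakpoints f \<subseteq> A" and sl: "slopes f \<subseteq> P"
    and x: "0 \<le> x" "x < 1"
  shows "\<exists>s\<in>P. \<exists>c\<in>A. \<exists>e>0. x + e \<le> 1 \<and> (\<forall>t\<in>{x..x + e}. f t = s * t + c)"
proof -
  obtain B where B: "finite B"
    "\<And>x y. \<lbrakk>0 \<le> x; x < y; y \<le> 1; {x<..<y} \<inter> B = {}\<rbrakk> \<Longrightarrow> \<exists>s. affine_with_slope s f {x..y}"
    using pl unfolding piecewise_linear_def by blast
  show ?thesis using x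
  proof (induction "card (B \<inter> {0<..x})" arbitrary: x rule: less_induct)
    case less
    obtain d where d: "0 < d" "{x<..<x + d} \<inter> B = {}" by (rule finite_isolated[OF B(1)])
    define e where "e = min d (1 - x)"
    have "{x<..<x + e} \<subseteq> {x<..<x + d}" unfolding e_def by auto
    then have e: "0 < e" "x + e \<le> 1" "{x<..<x + e} \<inter> B = {}"
      using d less.prems unfolding e_def by (simp, simp, blast)
    show ?case
    proof (cases "B \<inter> {0<..x} = {}")
      case True
      then have "{0<..<x + e} \<inter> B = {}" using e(3) less.prems by (force simp: not_less)
      then obtain s where s: "affine_with_slope s f {0..x + e}"
        using B(2)[of 0 "x + e"] e less.prems by auto
      then have "s \<in> P" using sl slopesI[OF s] e less.prems by auto
      moreover obtain c where c: "\<forall>t\<in>{0..x + e}. f t = s * t + c"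
        using s unfolding affine_with_slope_def by blast
      moreover have "c = 0" using c[rule_format, of 0] e less.prems f0 by simp
      ultimately show ?thesis using zero_A e less.prems
        by (intro bexI[of _ s] bexI[of _ c] exI[of _ e]) auto
    next
      case False
      define b where "b = Max (B \<inter> {0<..x})"
      have fin: "finite (B \<inter> {0<..x})" using B(1) by simp
      have b: "b \<in> B" "0 < b" "b \<le> x" using Max_in[OF fin False] unfolding b_def by auto
      have b_max: "t \<le> b" if "t \<in> B" "0 < t" "t \<le> x" for t
        using Max_ge[OF fin, of t] that unfolding b_def by simp
      have "{b<..<x + e} \<inter> B = {}"
      proof (rule ccontr)
        assume "{b<..<x + e} \<inter> B \<noteq> {}"
        then obtain t where t: "t \<in> B" "b < t" "t < x + e" by auto
        show False
        proof (cases "t \<le> x")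
          case True then show False using b_max[of t] t b by simp
        next
          case False
          then have "t \<in> {x<..<x + e} \<inter> B" using t by simp
          then show False using e(3) by blast
        qed
      qed
      then obtain s where s: "affine_with_slope s f {b..x + e}"
        using B(2)[of b "x + e"] e b less.prems by auto
      then have sP: "s \<in> P" using sl slopesI[OF s] e b by auto
      obtain c where c: "\<And>t. t \<in> {b..x + e} \<Longrightarrow> f t = s * t + c"
        using s unfolding affine_with_slope_def by blast
      obtain d' where d': "0 < d'" "{b - d'<..<b} \<inter> B = {}" by (rule finite_isolated[OF B(1)])
      define y where "y = max 0 (b - d')"
      have "{y<..<b} \<subseteq> {b - d'<..<b}" unfolding y_def by auto
      then have y: "0 \<le> y" "y < b" "{y<..<b} \<inter> B = {}" using d' b unfolding y_def by (simp, simp, blast)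
      have "b \<in> B \<inter> {0<..x}" "b \<notin> B \<inter> {0<..y}" "B \<inter> {0<..y} \<subseteq> B \<inter> {0<..x}"
        using y b by auto
      then have "card (B \<inter> {0<..y}) < card (B \<inter> {0<..x})"
        by (intro psubset_card_mono[OF fin]) blast
      moreover have "y < 1" using y b less.prems by simp
      ultimately obtain s' c' e' where IH: "s' \<in> P" "c' \<in> A" "0 < e'" "y + e' \<le> 1"
        "\<And>t. t \<in> {y..y + e'} \<Longrightarrow> f t = s' * t + c'"
        using less.hyps[of y] y(1) by metis
      obtain s2 where s2: "affine_with_slope s2 f {y..b}"
        using B(2)[of y b] y b less.prems by auto
      have "affine_with_slope s' f {y..y + e'}" using IH(5) unfolding affine_with_slope_def by blast
      then have "s2 = s'"
        using IH(3) y by (intro slope_unique[OF s2, of s' _ y "min b (y + e')"]) auto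
      then obtain c2 where c2: "\<And>t. t \<in> {y..b} \<Longrightarrow> f t = s' * t + c2"
        using s2 unfolding affine_with_slope_def by blast
      have "c2 = c'" using c2[of y] IH(5)[of y] IH(3) y by simp
      then have fb: "s' * b + c' = s * b + c" using c2[of b] c[of b] y b e by simp
      have "c \<in> A"
      proof (cases "b \<in> A")
        case True
        have "c = (s' * b + c') - s * b" using fb by simp
        then show ?thesis using True IH(1,2) sP by (metis diff_A add_A scale_A)
      next
        case False
        then have "b \<notin> breakpoints f" using br by blast
        then obtain l r s3 where lr: "l < b" "b < r" "affine_with_slope s3 f {l..r}"
          using b less.prems by (elim not_breakpointE) auto
        have "s = s3"
          using lr e b by (intro slope_unique[OF s lr(3), of b "min r (x + e)"]) auto
        moreover have "s2 = s3"
          using lr y by (intro slope_unique[OF s2 lr(3), of b "max l y"]) auto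
        ultimately have "c = c'" using fb \<open>s2 = s'\<close> by simp
        then show ?thesis using IH by simp
      qed
      then show ?thesis using sP c e b by (intro bexI[of _ s] bexI[of _ c] exI[of _ e]) auto
    qed
  qed
qed

text \<open>Breakpoints of composites and inverses are preimages and images of breakpoints, so this
  is what keeps them in \<open>A\<close>.\<close>

lemma apply_in_A_iff:
  assumes f: "f 0 = 0" "f 1 = 1" "piecewise_linear f" "breakpoints f \<subseteq> A" "slopes f \<subseteq> P" and x: "x \<in> {0..1}"
  shows "f x \<in> A \<longleftrightarrow> x \<in> A"
proof (cases "x = 1")
  case False
  then obtain s c e where s: "s \<in> P" "c \<in> A" "0 < e" "\<forall>t\<in>{x..x + e}. f t = s * t + c"
    using intercept_in_A[OF f(1,3-5), of x] x by auto
  then have fx: "f x = s * x + c" by simp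
  have "x = inverse s * (f x - c)" using fx pos_P[OF s(1)] by (simp add: field_simps)
  then show ?thesis using fx s by (metis diff_A add_A scale_A inverse_P)
qed (use f one_A in simp)

text \<open>A continuous bijection of the compact interval is a homeomorphism, so continuity replaces the
  homeomorphism condition in the definition.\<close>

lemma PL_groupI:
  assumes "f \<in> Bij {0..1}" "continuous_on {0..1} f" "strict_mono_on {0..1} f"
    "piecewise_linear f" "breakpoints f \<subseteq> A" "slopes f \<subseteq> P"
  shows "f \<in> carrier (PL_group A P)"
proof -
  have "\<exists>g. homeomorphism {0..1} {0..1} f g"
    using assms(1,2) by (intro homeomorphism_compact) (auto simp: Bij_def bij_betw_def)
  then show ?thesis using assms unfolding PL_group_def by (simp add: BijGroup_def)
qed

lemma PL_groupD:
  assumes "f \<in> carrier (PL_group A P)"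
  shows "f \<in> Bij {0..1}" "continuous_on {0..1} f" "strict_mono_on {0..1} f"
    "piecewise_linear f" "breakpoints f \<subseteq> A" "slopes f \<subseteq> P"
  using assms unfolding PL_group_def by (auto simp: BijGroup_def homeomorphism_def)

lemma PL_group_less_iff:
  assumes "f \<in> carrier (PL_group A P)" "x \<in> {0..1}" "y \<in> {0..1}"
  shows "f x < f y \<longleftrightarrow> x < y" "f x \<le> f y \<longleftrightarrow> x \<le> y"
  using strict_mono_on_less[OF PL_groupD(3)[OF assms(1)] assms(2,3)]
    strict_mono_on_less_eq[OF PL_groupD(3)[OF assms(1)] assms(2,3)] by auto

lemma PL_group_unit:
  assumes "f \<in> carrier (PL_group A P)" "x \<in> {0..1}" shows "f x \<in> {0..1}"
  using Bij_imp_funcset[OF PL_groupD(1)[OF assms(1)]] assms(2) by (rule funcset_mem)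

lemma PL_group_surj:
  assumes "f \<in> carrier (PL_group A P)" "y \<in> {0..1}"
  obtains x where "x \<in> {0..1}" "f x = y"
proof -
  have "f ` {0..1} = {0..1}" using PL_groupD(1)[OF assms(1)] by (simp add: Bij_def bij_betw_def)
  then show thesis using assms(2) that by (metis imageE)
qed

lemma PL_group_ends:
  assumes f: "f \<in> carrier (PL_group A P)" shows "f 0 = 0" "f 1 = 1"
proof -
  obtain x where x: "x \<in> {0..1}" "f x = 0" using PL_group_surj[OF f, of 0] by auto
  then have "f 0 \<le> 0" using PL_group_less_iff(2)[OF f, of 0 x] by simp
  then show "f 0 = 0" using PL_group_unit[OF f, of 0] by simp
  obtain y where y: "y \<in> {0..1}" "f y = 1" using PL_group_surj[OF f, of 1] by auto
  then have "1 \<le> f 1" using PL_group_less_iff(2)[OF f, of y 1] by simp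
  then show "f 1 = 1" using PL_group_unit[OF f, of 1] by simp
qed

lemma PL_group_in_A_iff:
  assumes f: "f \<in> carrier (PL_group A P)" and x: "x \<in> {0..1}"
  shows "f x \<in> A \<longleftrightarrow> x \<in> A"
  using apply_in_A_iff[OF PL_group_ends[OF f] PL_groupD(4-6)[OF f] x] .

text \<open>A slope of \<open>f \<circ> g\<close> is a product of one of \<open>f\<close> and one of \<open>g\<close>, seen on a sufficiently short interval,
  and the composite is affine near a point outside \<open>A\<close> because \<open>g\<close> is affine there and sends it to a
  point outside \<open>A\<close>.\<close>

lemma PL_group_compose:
  assumes f: "f \<in> carrier (PL_group A P)" and g: "g \<in> carrier (PL_group A P)"
  shows "compose {0..1} f g \<in> carrier (PL_group A P)" (is "?h \<in> _")
proof (rule PL_groupI)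
  have h: "?h t = f (g t)" if "t \<in> {0..1}" for t using that by (simp add: compose_eq)
  have aff: "affine_with_slope (s' * s) ?h {x..y}"
    if "affine_with_slope s g {x..y}" "affine_with_slope s' f {g x..g y}" "0 \<le> x" "x < y" "y \<le> 1" for s s' x y
  proof -
    have "g t \<in> {g x..g y}" if "t \<in> {x..y}" for t
      using that \<open>0 \<le> x\<close> \<open>x < y\<close> \<open>y \<le> 1\<close> PL_group_less_iff(2)[OF g, of x t] PL_group_less_iff(2)[OF g, of t y] by simp
    then have "affine_with_slope (s' * s) (\<lambda>t. f (g t)) {x..y}"
      by (rule affine_with_slope_compose[OF \<open>affine_with_slope s g _\<close> \<open>affine_with_slope s' f _\<close>])
    moreover have "affine_with_slope (s' * s) (\<lambda>t. f (g t)) {x..y} \<longleftrightarrow> affine_with_slope (s' * s) ?h {x..y}"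
      by (rule affine_with_slope_cong) (use that in \<open>simp add: h\<close>)
    ultimately show ?thesis by blast
  qed
  have gs: "g x \<in> {0..1}" if "x \<in> {0..1}" for x using PL_group_unit[OF g that] .
  show "?h \<in> Bij {0..1}" using compose_Bij PL_groupD(1) f g by blast
  have "continuous_on {0..1} (\<lambda>t. f (g t))"
    by (rule continuous_on_compose2[OF PL_groupD(2)[OF f] PL_groupD(2)[OF g]]) (use gs in blast)
  then show "continuous_on {0..1} ?h" by (rule continuous_on_eq) (simp add: h)
  show "strict_mono_on {0..1} ?h"
  proof (rule strict_mono_onI)
    fix r s :: real assume "r \<in> {0..1}" "s \<in> {0..1}" "r < s"
    then show "?h r < ?h s"
      unfolding h[OF \<open>r \<in> {0..1}\<close>] h[OF \<open>s \<in> {0..1}\<close>]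
      using PL_group_less_iff(1)[OF g, of r s] PL_group_less_iff(1)[OF f gs gs, of r s] by blast
  qed
  show "piecewise_linear ?h"
  proof -
    obtain Bg where Bg: "finite Bg"
      "\<And>x y. \<lbrakk>0 \<le> x; x < y; y \<le> 1; {x<..<y} \<inter> Bg = {}\<rbrakk> \<Longrightarrow> \<exists>s. affine_with_slope s g {x..y}"
      using PL_groupD(4)[OF g] unfolding piecewise_linear_def by blast
    obtain Bf where Bf: "finite Bf"
      "\<And>x y. \<lbrakk>0 \<le> x; x < y; y \<le> 1; {x<..<y} \<inter> Bf = {}\<rbrakk> \<Longrightarrow> \<exists>s. affine_with_slope s f {x..y}"
      using PL_groupD(4)[OF f] unfolding piecewise_linear_def by blast
    have inj: "inj_on g {0..1}" using PL_groupD(3)[OF g] by (rule strict_mono_on_imp_inj_on)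
    define B where "B = Bg \<union> {t \<in> {0..1}. g t \<in> Bf}"
    have "finite B" unfolding B_def using Bg(1) finite_inverse_image_gen[OF Bf(1) inj] by simp
    moreover have "\<exists>s. affine_with_slope s ?h {x..y}"
      if xy: "0 \<le> x" "x < y" "y \<le> 1" "{x<..<y} \<inter> B = {}" for x y
    proof -
      have "{x<..<y} \<inter> Bg = {}" using xy(4) unfolding B_def by blast
      then obtain s where s: "affine_with_slope s g {x..y}" using Bg(2) xy by blast
      have "{g x<..<g y} \<inter> Bf = {}"
      proof (rule ccontr)
        assume "{g x<..<g y} \<inter> Bf \<noteq> {}"
        then obtain u where u: "u \<in> Bf" "g x < u" "u < g y" by auto
        then have "u \<in> {0..1}" using gs[of x] gs[of y] xy by simp
        then obtain t where t: "t \<in> {0..1}" "g t = u" by (rule PL_group_surj[OF g])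
        then have "x < t" "t < y"
          using u xy PL_group_less_iff(1)[OF g, of x t] PL_group_less_iff(1)[OF g, of t y] by simp_all
        then have "t \<in> {x<..<y} \<inter> B" using t u unfolding B_def by simp
        then show False using xy(4) by blast
      qed
      moreover have "0 \<le> g x" "g x < g y" "g y \<le> 1"
        using gs[of x] gs[of y] xy PL_group_less_iff(1)[OF g, of x y] by simp_all
      ultimately obtain s' where "affine_with_slope s' f {g x..g y}" using Bf(2) by blast
      then show ?thesis using aff[OF s _ xy(1-3)] by blast
    qed
    ultimately show ?thesis unfolding piecewise_linear_def by blast
  qed
  show "breakpoints ?h \<subseteq> A"
  proof
    fix x assume x: "x \<in> breakpoints ?h"
    then have x01: "0 < x" "x < 1" unfolding breakpoints_def by auto
    show "x \<in> A"
    proof (rule ccontr)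
      assume xA: "x \<notin> A"
      then have "x \<notin> breakpoints g" using PL_groupD(5)[OF g] by blast
      then obtain a b s where ab: "0 \<le> a" "a < x" "x < b" "b \<le> 1" "affine_with_slope s g {a..b}"
        using x01 by (rule not_breakpointE)
      have "g x \<notin> A" using PL_group_in_A_iff[OF g, of x] x01 xA by simp
      then have "g x \<notin> breakpoints f" using PL_groupD(5)[OF f] by blast
      moreover have "0 < g x" "g x < 1"
        using PL_group_less_iff(1)[OF g, of 0 x] PL_group_less_iff(1)[OF g, of x 1] PL_group_ends[OF g] x01 by simp_all
      ultimately obtain a' b' s' where ab': "0 \<le> a'" "a' < g x" "g x < b'" "b' \<le> 1" "affine_with_slope s' f {a'..b'}"
        by (rule not_breakpointE)
      obtain u where u: "u \<in> {0..1}" "g u = a'" using PL_group_surj[OF g, of a'] ab' by auto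
      obtain v where v: "v \<in> {0..1}" "g v = b'" using PL_group_surj[OF g, of b'] ab' by auto
      have uv: "u < x" "x < v"
        using u v ab' x01 PL_group_less_iff(1)[OF g, of u x] PL_group_less_iff(1)[OF g, of x v] by simp_all
      define l where "l = max a u"
      define r where "r = min b v"
      have lr: "0 \<le> l" "l < x" "x < r" "r \<le> 1" "{l..r} \<subseteq> {a..b}" "u \<le> l" "r \<le> v"
        unfolding l_def r_def using ab uv by auto
      have "a' \<le> g l" "g r \<le> b'"
        using lr u v PL_group_less_iff(2)[OF g, of u l] PL_group_less_iff(2)[OF g, of r v] x01 by simp_all
      then have "affine_with_slope s' f {g l..g r}"
        by (intro affine_with_slope_subset[OF ab'(5)]) auto
      then have "affine_with_slope (s' * s) ?h {l..r}"
        using lr by (intro aff affine_with_slope_subset[OF ab(5)]) auto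
      then have "x \<notin> breakpoints ?h" using lr by (intro not_breakpointI) auto
      then show False using x by simp
    qed
  qed
  show "slopes ?h \<subseteq> P"
  proof
    fix m assume "m \<in> slopes ?h"
    then obtain x y where xy: "0 \<le> x" "x < y" "y \<le> 1" "affine_with_slope m ?h {x..y}"
      unfolding slopes_def by blast
    have x1: "x < 1" using xy by simp
    obtain e s where e: "0 < e" "x + e \<le> 1" "affine_with_slope s g {x..x + e}"
      using piecewise_linear_right[OF PL_groupD(4)[OF g] xy(1) x1] .
    have gx: "0 \<le> g x" "g x < 1"
      using gs[of x] PL_group_less_iff(1)[OF g, of x 1] PL_group_ends[OF g] x1 xy by simp_all
    obtain e' s' where e': "0 < e'" "g x + e' \<le> 1" "affine_with_slope s' f {g x..g x + e'}"
      using piecewise_linear_right[OF PL_groupD(4)[OF f] gx] .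
    obtain v where v: "v \<in> {0..1}" "g v = g x + e'" using PL_group_surj[OF g, of "g x + e'"] e' gx by auto
    have xv: "x < v" using v e' xy PL_group_less_iff(1)[OF g, of x v] by simp
    define z where "z = min (x + e) v"
    have z: "x < z" "z \<le> x + e" "z \<le> v" "z \<le> 1" unfolding z_def using e xv v by auto
    have "g z \<le> g x + e'" using v z xy PL_group_less_iff(2)[OF g, of z v] by simp
    then have "affine_with_slope s' f {g x..g z}"
      by (intro affine_with_slope_subset[OF e'(3)]) auto
    then have "affine_with_slope (s' * s) ?h {x..z}"
      using z xy by (intro aff affine_with_slope_subset[OF e(3)]) auto
    then have "m = s' * s"
      using z xy by (intro slope_unique[OF xy(4), of _ _ x "min y z"]) auto
    moreover have "s \<in> P" using PL_groupD(6)[OF g] slopesI[OF e(3)] e xy by auto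
    moreover have "s' \<in> P" using PL_groupD(6)[OF f] slopesI[OF e'(3)] e' gx by auto
    ultimately show "m \<in> P" using mult_P by simp
  qed
qed

lemma PL_group_inverse:
  assumes f: "f \<in> carrier (PL_group A P)"
  shows "(\<lambda>x\<in>{0..1}. inv_into {0..1} f x) \<in> carrier (PL_group A P)" (is "?g \<in> _")
proof (rule PL_groupI)
  have gB: "?g \<in> Bij {0..1}" using restrict_inv_into_Bij[OF PL_groupD(1)[OF f]] .
  then show "?g \<in> Bij {0..1}" .
  have im: "f ` {0..1} = {0..1}" and inj: "inj_on f {0..1}"
    using PL_groupD(1)[OF f] by (simp_all add: Bij_def bij_betw_def)
  have gs: "?g t \<in> {0..1}" if "t \<in> {0..1}" for t
    using Bij_imp_funcset[OF gB] that by (rule funcset_mem)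
  have fg: "f (?g t) = t" if "t \<in> {0..1}" for t
    using that im by (simp add: f_inv_into_f)
  have fs: "f t \<in> {0..1}" if "t \<in> {0..1}" for t
    using PL_group_unit[OF f that] .
  have gf: "?g (f t) = t" if "t \<in> {0..1}" for t
    using fs[OF that] inv_into_f_f[OF inj that] by simp
  have g_less: "?g x < ?g y \<longleftrightarrow> x < y" "?g x \<le> ?g y \<longleftrightarrow> x \<le> y" if "x \<in> {0..1}" "y \<in> {0..1}" for x y
    using PL_group_less_iff[OF f gs[OF that(1)] gs[OF that(2)]] fg[OF that(1)] fg[OF that(2)] by simp_all
  have aff: "affine_with_slope (inverse s) ?g {x..y}"
    if "affine_with_slope s f {?g x..?g y}" "0 \<le> x" "x < y" "y \<le> 1" for s x y
  proof (rule affine_with_slope_inverse[OF that(1)])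
    have "s \<in> slopes f"
      using that gs[of x] gs[of y] g_less(1)[of x y] by (intro slopesI[OF that(1)]) auto
    then have "s \<in> P" using PL_groupD(6)[OF f] by blast
    then show "s \<noteq> 0" using pos_P[of s] by simp
    show "f (?g t) = t" if "t \<in> {x..y}" for t
      using that \<open>0 \<le> x\<close> \<open>y \<le> 1\<close> by (intro fg) auto
    show "?g t \<in> {?g x..?g y}" if "t \<in> {x..y}" for t
    proof -
      have "x \<in> {0..1}" "y \<in> {0..1}" "t \<in> {0..1}" "x \<le> t" "t \<le> y" using that \<open>0 \<le> x\<close> \<open>x < y\<close> \<open>y \<le> 1\<close> by auto
      then show ?thesis using g_less(2) by (metis atLeastAtMost_iff)
    qed
  qed
  have "continuous_on (f ` {0..1}) ?g"
    by (rule continuous_on_inv[OF PL_groupD(2)[OF f]]) (use gf in auto)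
  then show "continuous_on {0..1} ?g" using im by simp
  show "strict_mono_on {0..1} ?g" using g_less(1) by (intro strict_mono_onI) blast
  show "piecewise_linear ?g"
  proof -
    obtain B where B: "finite B"
      "\<And>x y. \<lbrakk>0 \<le> x; x < y; y \<le> 1; {x<..<y} \<inter> B = {}\<rbrakk> \<Longrightarrow> \<exists>s. affine_with_slope s f {x..y}"
      using PL_groupD(4)[OF f] unfolding piecewise_linear_def by blast
    have "\<exists>s. affine_with_slope s ?g {x..y}"
      if xy: "0 \<le> x" "x < y" "y \<le> 1" "{x<..<y} \<inter> f ` B = {}" for x y
    proof -
      have xy': "x \<in> {0..1}" "y \<in> {0..1}" using xy by auto
      have "{?g x<..<?g y} \<inter> B = {}"
      proof (rule ccontr)
        assume "{?g x<..<?g y} \<inter> B \<noteq> {}"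
        then obtain u where u: "u \<in> B" "?g x < u" "u < ?g y" by auto
        have u01: "u \<in> {0..1}" using u gs[OF xy'(1)] gs[OF xy'(2)] by (meson atLeastAtMost_iff le_less_trans less_imp_le order_trans)
        have "x < f u" "f u < y"
          using u PL_group_less_iff(1)[OF f gs[OF xy'(1)] u01] PL_group_less_iff(1)[OF f u01 gs[OF xy'(2)]]
            fg[OF xy'(1)] fg[OF xy'(2)] by simp_all
        then show False using u xy(4) by auto
      qed
      moreover have "0 \<le> ?g x" "?g y \<le> 1"
        using gs[OF xy'(1)] gs[OF xy'(2)] by (meson atLeastAtMost_iff)+
      moreover have "?g x < ?g y" using g_less(1)[OF xy'] xy by blast
      ultimately obtain s where "affine_with_slope s f {?g x..?g y}" using B(2) by blast
      then show ?thesis using aff xy by blast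
    qed
    then show ?thesis using B(1) unfolding piecewise_linear_def by (intro exI[of _ "f ` B"]) auto
  qed
  show "breakpoints ?g \<subseteq> A"
  proof
    fix y assume y: "y \<in> breakpoints ?g"
    then have y01: "0 < y" "y < 1" "y \<in> {0..1}" unfolding breakpoints_def by auto
    obtain x where x: "x \<in> {0..1}" "f x = y" using PL_group_surj[OF f y01(3)] .
    have x01: "0 < x" "x < 1"
      using PL_group_less_iff(1)[OF f, of 0 x] PL_group_less_iff(1)[OF f, of x 1] PL_group_ends[OF f] x y01 by simp_all
    show "y \<in> A"
    proof (rule ccontr)
      assume "y \<notin> A"
      then have "x \<notin> A" using PL_group_in_A_iff[OF f x(1)] x by simp
      then have "x \<notin> breakpoints f" using PL_groupD(5)[OF f] by blast
      then obtain a b s where ab: "0 \<le> a" "a < x" "x < b" "b \<le> 1" "affine_with_slope s f {a..b}"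
        using x01 by (rule not_breakpointE)
      have ab01: "a \<in> {0..1}" "b \<in> {0..1}" using ab x01 by auto
      have lt: "f a < y" "y < f b"
        using PL_group_less_iff(1)[OF f ab01(1) x(1)] PL_group_less_iff(1)[OF f x(1) ab01(2)] x ab by simp_all
      have "affine_with_slope s f {?g (f a)..?g (f b)}" using ab(5) gf[OF ab01(1)] gf[OF ab01(2)] by simp
      then have "affine_with_slope (inverse s) ?g {f a..f b}"
        using lt fs[OF ab01(1)] fs[OF ab01(2)] by (intro aff) auto
      then have "y \<notin> breakpoints ?g" using lt by (rule not_breakpointI)
      then show False using y by simp
    qed
  qed
  show "slopes ?g \<subseteq> P"
  proof
    fix m assume "m \<in> slopes ?g"
    then obtain x y where xy: "0 \<le> x" "x < y" "y \<le> 1" "affine_with_slope m ?g {x..y}"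
      unfolding slopes_def by blast
    obtain u where u: "u \<in> {0..1}" "f u = x" using PL_group_surj[OF f, of x] xy by auto
    have u1: "0 \<le> u" "u < 1" using PL_group_less_iff(1)[OF f, of u 1] PL_group_ends[OF f] u xy by simp_all
    obtain e s where e: "0 < e" "u + e \<le> 1" "affine_with_slope s f {u..u + e}"
      using piecewise_linear_right[OF PL_groupD(4)[OF f] u1] .
    have ue: "u + e \<in> {0..1}" using e u1 by simp
    have lt: "x < f (u + e)" using PL_group_less_iff(1)[OF f u(1) ue] u e by simp
    have "affine_with_slope s f {?g x..?g (f (u + e))}" using e(3) gf[OF u(1)] gf[OF ue] u(2) by simp
    then have "affine_with_slope (inverse s) ?g {x..f (u + e)}"
      using lt fs[OF ue] xy by (intro aff) auto
    then have "m = inverse s"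
      using lt xy by (intro slope_unique[OF xy(4), of _ _ x "min y (f (u + e))"]) auto
    moreover have "s \<in> P" using PL_groupD(6)[OF f] slopesI[OF e(3)] e u1 by auto
    ultimately show "m \<in> P" using inverse_P by simp
  qed
qed

lemma subgroup_PL_group: "subgroup (carrier (PL_group A P)) (BijGroup {0..1})"
proof -
  interpret Bij: group "BijGroup {0..1::real}" by (rule group_BijGroup)
  show ?thesis
  proof (rule Bij.subgroupI)
    show "carrier (PL_group A P) \<subseteq> carrier (BijGroup {0..1})"
      using PL_groupD(1) by (auto simp: BijGroup_def)
    have "(\<lambda>x\<in>{0..1}. x) \<in> carrier (PL_group A P)"
    proof (rule PL_groupI)
      let ?i = "\<lambda>x\<in>{0..1::real}. x"
      show "?i \<in> Bij {0..1}" by (rule id_Bij)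
      show "continuous_on {0..1} ?i" by (rule continuous_on_eq[OF continuous_on_id]) auto
      show "strict_mono_on {0..1} ?i" by (rule strict_mono_onI) auto
      have aff: "affine_with_slope 1 ?i {x..y}" if "0 \<le> x" "y \<le> 1" for x y
        unfolding affine_with_slope_def by (rule exI[of _ 0]) (use that in auto)
      show "piecewise_linear ?i"
        unfolding piecewise_linear_def by (rule exI[of _ "{}"]) (use aff in blast)
      have "x \<notin> breakpoints ?i" if "0 < x" "x < 1" for x
        using aff[of 0 1] that by (intro not_breakpointI) auto
      then show "breakpoints ?i \<subseteq> A" unfolding breakpoints_def by auto
      show "slopes ?i \<subseteq> P"
      proof
        fix s assume "s \<in> slopes ?i"
        then obtain x y where xy: "0 \<le> x" "x < y" "y \<le> 1" "affine_with_slope s ?i {x..y}"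
          unfolding slopes_def by blast
        then have "s = 1" by (intro slope_unique[OF xy(4) aff[of x y], of x y]) auto
        then show "s \<in> P" using one_P by simp
      qed
    qed
    then show "carrier (PL_group A P) \<noteq> {}" by blast
    show "inv\<^bsub>BijGroup {0..1}\<^esub> f \<in> carrier (PL_group A P)" if "f \<in> carrier (PL_group A P)" for f
      using PL_group_inverse[OF that] inv_BijGroup[OF PL_groupD(1)[OF that]] by simp
    show "f \<otimes>\<^bsub>BijGroup {0..1}\<^esub> g \<in> carrier (PL_group A P)"
      if "f \<in> carrier (PL_group A P)" "g \<in> carrier (PL_group A P)" for f g
      using PL_group_compose[OF that] PL_groupD(1)[OF that(1)] PL_groupD(1)[OF that(2)]
      by (simp add: BijGroup_def)
  qed
qed

lemma increasing_homeo_group_PL: "increasing_homeo_group (PL_group A P)"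
proof -
  have eq: "PL_group A P = BijGroup {0..1}\<lparr>carrier := carrier (PL_group A P)\<rparr>"
    unfolding PL_group_def by simp
  have mult: "mult (PL_group A P) = mult (BijGroup {0..1})" and one: "one (PL_group A P) = one (BijGroup {0..1})"
    unfolding PL_group_def by simp_all
  have "group (PL_group A P)"
    using subgroup.subgroup_is_group[OF subgroup_PL_group group_BijGroup] eq by simp
  then show ?thesis
  proof (rule increasing_homeo_group.intro, intro increasing_homeo_group_axioms.intro)
    fix g h and x :: real assume gh: "g \<in> carrier (PL_group A P)" "h \<in> carrier (PL_group A P)" and x: "x \<in> {0..1}"
    show "(g \<otimes>\<^bsub>PL_group A P\<^esub> h) x = g (h x)"
      using PL_groupD(1)[OF gh(1)] PL_groupD(1)[OF gh(2)] x unfolding mult by (simp add: BijGroup_def compose_eq)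
  next
    fix x :: real assume "x \<in> {0..1}"
    then show "\<one>\<^bsub>PL_group A P\<^esub> x = x" unfolding one by (simp add: BijGroup_def)
  next
    fix g h assume gh: "g \<in> carrier (PL_group A P)" "h \<in> carrier (PL_group A P)"
      and eq: "\<And>x. x \<in> {0..1} \<Longrightarrow> g x = h x"
    show "g = h"
      using Bij_imp_extensional[OF PL_groupD(1)[OF gh(1)]] Bij_imp_extensional[OF PL_groupD(1)[OF gh(2)]] eq
      by (rule extensionalityI)
  qed (use PL_groupD(2,3) PL_group_unit in blast)+
qed

end

section \<open>Linear germs\<close>

context increasing_homeo_group
begin

text \<open>Every element fixes both endpoints, so an affine germ at \<open>z\<close> is determined by its slope.\<close>

definition linear_germ :: "real \<Rightarrow> (real \<Rightarrow> real) \<Rightarrow> real \<Rightarrow> bool" where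
  "linear_germ z g s \<longleftrightarrow> (\<forall>\<^sub>F x in at z within {0<..<1}. g x = z + s * (x - z))"

lemma linear_germ_mult:
  assumes G: "g \<in> carrier G" "h \<in> carrier G" and z: "z \<in> {0, 1}"
    and g: "linear_germ z g s" and h: "linear_germ z h t"
  shows "linear_germ z (g \<otimes> h) (s * t)"
proof -
  have "\<forall>\<^sub>F x in at z within {0<..<1}. g (h x) = z + s * (h x - z)"
    using filterlim_endpoint[OF G(2) z] g unfolding linear_germ_def filterlim_iff by blast
  with h[unfolded linear_germ_def] eventually_interior[of z] show ?thesis
    unfolding linear_germ_def
  proof eventually_elim
    case (elim x)
    then show ?case using mult_apply[OF G, of x] by simp
  qed
qed

lemma linear_germ_inv:
  assumes G: "g \<in> carrier G" and z: "z \<in> {0, 1}" and g: "linear_germ z g s" and s: "s \<noteq> 0"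
  shows "linear_germ z (inv g) (inverse s)"
proof -
  have "\<forall>\<^sub>F x in at z within {0<..<1}. g ((inv g) x) = z + s * ((inv g) x - z)"
    using filterlim_endpoint[OF inv_closed[OF G] z] g unfolding linear_germ_def filterlim_iff by blast
  with eventually_interior[of z] show ?thesis
    unfolding linear_germ_def
  proof eventually_elim
    case (elim x)
    then have "x = z + s * ((inv g) x - z)" using inv_apply(2)[OF G, of x] by simp
    then show ?case using s by (simp add: field_simps)
  qed
qed

lemma linear_germ_int_pow:
  assumes G: "g \<in> carrier G" and z: "z \<in> {0, 1}" and g: "linear_germ z g s" and s: "s \<noteq> 0"
  shows "linear_germ z (g [^] (k::int)) (s powi k)"
proof -
  have nat: "linear_germ z (g [^] n) (s ^ n)" for n :: nat
  proof (induction n)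
    case 0
    have "\<forall>\<^sub>F x in at z within {0<..<1}. \<one> x = z + 1 * (x - z)"
      using eventually_interior[of z] by eventually_elim (simp add: one_apply)
    then show ?case unfolding linear_germ_def by simp
  next
    case (Suc n)
    then show ?case using linear_germ_mult[OF _ G z Suc g] G by (simp add: mult.commute)
  qed
  show ?thesis
  proof (cases "0 \<le> k")
    case True
    then obtain n where "k = int n" using nonneg_int_cases by blast
    then show ?thesis using nat[of n] by (simp add: int_pow_int)
  next
    case False
    then have "k = - int (nat (- k))" by simp
    then obtain n where "k = - int n" by blast
    then show ?thesis
      using linear_germ_inv[OF nat_pow_closed[OF G] z nat[of n]] s G by (simp add: int_pow_neg_int power_int_minus)
  qed
qed

lemma same_germ_if_linear_germ:
  assumes "linear_germ z g s" "linear_germ z h s" shows "same_germ z g h"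
  using assms unfolding linear_germ_def same_germ_def by eventually_elim simp

end

section \<open>Slopes that are powers of one number\<close>

lemma int_powers_inverse: "int_powers (inverse x) = int_powers x"
proof -
  have subset: "int_powers (inverse y) \<subseteq> int_powers y" for y
  proof
    fix s assume "s \<in> int_powers (inverse y)"
    then obtain k where "s = inverse y powi k" unfolding int_powers_def by blast
    then have "s = y powi (- k)" by (simp add: power_int_inverse power_int_minus)
    then show "s \<in> int_powers y" unfolding int_powers_def by blast
  qed
  show ?thesis using subset[of x] subset[of "inverse x"] by simp
qed

text \<open>The bound \<open>l + l\<^sup>2 \<le> 1\<close> leaves room for the three pieces of the map below; for the golden ratio it
  is an equality and the middle piece degenerates to a point.\<close>

locale cyclic_slopes =
  fixes A :: "real set" and l :: real
  assumes zero_A: "0 \<in> A" and one_A: "1 \<in> A"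
    and diff_A: "\<lbrakk>a \<in> A; b \<in> A\<rbrakk> \<Longrightarrow> a - b \<in> A"
    and mult_A: "a \<in> A \<Longrightarrow> l * a \<in> A"
    and divide_A: "a \<in> A \<Longrightarrow> a / l \<in> A"
    and l_pos: "0 < l" and l_small: "l + l\<^sup>2 \<le> 1"
begin

lemma l_less_1: "l < 1"
  using l_small l_pos zero_less_power[OF l_pos, of 2] by linarith

sublocale slope_group A "int_powers l"
proof
  fix s t a assume s: "s \<in> int_powers l"
  then obtain k where k: "s = l powi k" unfolding int_powers_def by blast
  show "0 < s" using k l_pos by simp
  show "inverse s \<in> int_powers l" unfolding k int_powers_def by (metis power_int_minus rangeI)
  show "s * t \<in> int_powers l" if t: "t \<in> int_powers l"
  proof -
    obtain j where "t = l powi j" using t unfolding int_powers_def by blast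
    then have "s * t = l powi (k + j)" using k l_pos by (simp add: power_int_add)
    then show ?thesis unfolding int_powers_def by blast
  qed
  show "s * a \<in> A" if a: "a \<in> A"
  proof (cases "0 \<le> k")
    case True
    then obtain n where n: "k = int n" using nonneg_int_cases by blast
    have "l ^ n * a \<in> A" by (induction n) (use a mult_A in \<open>auto simp: mult.assoc\<close>)
    then show ?thesis using k n by simp
  next
    case False
    then have "k = - int (nat (- k))" by simp
    then obtain n where n: "k = - int n" by blast
    have "a / l ^ n \<in> A" 
    proof (induction n)
      case (Suc n)
      have "a / l ^ Suc n = (a / l ^ n) / l" by simp
      then show ?case using divide_A[OF Suc] by (simp only:)
    qed (use a in simp)
    then show ?thesis using k n by (simp add: power_int_minus field_simps)
  qed
next
  have "1 = l powi 0" by simp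
  then show "1 \<in> int_powers l" unfolding int_powers_def by blast
qed (use zero_A one_A diff_A in blast)+

text \<open>The map with slope \<open>l\<close> on \<open>[0, l]\<close>, slope \<open>1\<close> on \<open>[l, 1 - l\<^sup>2]\<close> and slope \<open>1/l\<close> on \<open>[1 - l\<^sup>2, 1]\<close>. The first
  piece loses \<open>l - l\<^sup>2\<close> against the diagonal, and the last one regains exactly this. The slopes increase,
  so the map is convex and is the maximum of its three affine pieces; in this form continuity and
  monotonicity are immediate.\<close>

definition three_slope_map :: "real \<Rightarrow> real" where
  "three_slope_map = (\<lambda>t\<in>{0..1}. max (l * t) (max (t - l + l\<^sup>2) (1 - (1 - t) / l)))"

lemma three_slope_map_apply:
  assumes "0 \<le> t" "t \<le> 1"
  shows "three_slope_map t = max (l * t) (max (t - l + l\<^sup>2) (1 - (1 - t) / l))"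
  using assms unfolding three_slope_map_def by simp

lemma three_slope_map_pieces:
  assumes "0 \<le> t" "t \<le> 1"
  shows "t \<le> l \<Longrightarrow> three_slope_map t = l * t"
    and "l \<le> t \<Longrightarrow> t \<le> 1 - l\<^sup>2 \<Longrightarrow> three_slope_map t = t - l + l\<^sup>2"
    and "1 - l\<^sup>2 \<le> t \<Longrightarrow> three_slope_map t = 1 - (1 - t) / l"
proof -
  have d1: "l * t - (t - l + l\<^sup>2) = (l - t) * (1 - l)" by (simp add: algebra_simps power2_eq_square)
  have d2: "(t - l + l\<^sup>2) - (1 - (1 - t) / l) = (1 - l\<^sup>2 - t) * (1 - l) / l"
    using l_pos by (simp add: field_simps power2_eq_square)
  have c1: "t - l + l\<^sup>2 \<le> l * t" if "t \<le> l"
    using mult_nonneg_nonneg[of "l - t" "1 - l"] that l_less_1 d1 by linarith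
  have c1': "l * t \<le> t - l + l\<^sup>2" if "l \<le> t"
    using mult_nonneg_nonneg[of "t - l" "1 - l"] that l_less_1 d1 by (simp add: algebra_simps)
  have c2: "1 - (1 - t) / l \<le> t - l + l\<^sup>2" if "t \<le> 1 - l\<^sup>2"
  proof -
    have "0 \<le> (1 - l\<^sup>2 - t) * (1 - l) / l" using that l_less_1 l_pos by (intro divide_nonneg_pos mult_nonneg_nonneg) auto
    then show ?thesis using d2 by linarith
  qed
  have c2': "t - l + l\<^sup>2 \<le> 1 - (1 - t) / l" if "1 - l\<^sup>2 \<le> t"
  proof -
    have "(1 - l\<^sup>2 - t) * (1 - l) / l \<le> 0" using that l_less_1 l_pos by (intro divide_nonpos_pos mult_nonpos_nonneg) auto
    then show ?thesis using d2 by linarith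
  qed
  show "three_slope_map t = l * t" if "t \<le> l"
    using c1[OF that] c2 that l_small three_slope_map_apply[OF assms] by simp
  show "three_slope_map t = t - l + l\<^sup>2" if "l \<le> t" "t \<le> 1 - l\<^sup>2"
    using c1'[OF that(1)] c2[OF that(2)] three_slope_map_apply[OF assms] by simp
  show "three_slope_map t = 1 - (1 - t) / l" if "1 - l\<^sup>2 \<le> t"
    using c2'[OF that] c1' that l_small three_slope_map_apply[OF assms] by simp
qed

lemma three_slope_map_affine:
  assumes xy: "0 \<le> x" "x < y" "y \<le> 1" "{x<..<y} \<inter> {l, 1 - l\<^sup>2} = {}"
  shows "\<exists>s\<in>int_powers l. affine_with_slope s three_slope_map {x..y}"
proof -
  have "\<not> (x < l \<and> l < y)" "\<not> (x < 1 - l\<^sup>2 \<and> 1 - l\<^sup>2 < y)" using xy(4) by auto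
  then consider "y \<le> l" | "l \<le> x" "y \<le> 1 - l\<^sup>2" | "1 - l\<^sup>2 \<le> x" using xy l_small by linarith
  then show ?thesis
  proof cases
    case 1
    then have "affine_with_slope l three_slope_map {x..y}"
      unfolding affine_with_slope_def using xy by (intro exI[of _ 0]) (auto simp: three_slope_map_pieces(1))
    moreover have "l = l powi 1" by simp
    ultimately show ?thesis unfolding int_powers_def by blast
  next
    case 2
    then have "affine_with_slope 1 three_slope_map {x..y}"
      unfolding affine_with_slope_def using xy by (intro exI[of _ "- l + l\<^sup>2"]) (auto simp: three_slope_map_pieces(2))
    then show ?thesis using one_P by blast
  next
    case 3
    then have "affine_with_slope (inverse l) three_slope_map {x..y}"
      unfolding affine_with_slope_def using xy l_pos
      by (intro exI[of _ "1 - 1 / l"]) (auto simp: three_slope_map_pieces(3) field_simps)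
    moreover have "inverse l = l powi (- 1)" by (simp add: power_int_minus)
    ultimately show ?thesis unfolding int_powers_def by blast
  qed
qed

lemma three_slope_map_in_PL_group: "three_slope_map \<in> carrier (PL_group A (int_powers l))"
proof (rule PL_groupI)
  show cont: "continuous_on {0..1} three_slope_map"
  proof -
    have "continuous_on {0..1} (\<lambda>t. max (l * t) (max (t - l + l\<^sup>2) (1 - (1 - t) / l)))"
      using l_pos by (intro continuous_intros) auto
    then show ?thesis by (rule continuous_on_eq) (simp add: three_slope_map_def)
  qed
  show mono: "strict_mono_on {0..1} three_slope_map"
  proof (rule strict_mono_onI)
    fix r s :: real assume rs: "r \<in> {0..1}" "s \<in> {0..1}" "r < s"
    have "l * r < l * s" using l_pos rs by simp
    moreover have "(1 - s) / l < (1 - r) / l" using l_pos rs by (intro divide_strict_right_mono) auto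
    ultimately show "three_slope_map r < three_slope_map s" using rs three_slope_map_apply[of r] three_slope_map_apply[of s] by auto
  qed
  have ends: "three_slope_map 0 = 0" "three_slope_map 1 = 1" using three_slope_map_pieces(1)[of 0] three_slope_map_pieces(3)[of 1] l_pos by simp_all
  have "three_slope_map ` {0..1} = {0..1}"
  proof
    show "three_slope_map ` {0..1} \<subseteq> {0..1}"
    proof
      fix y assume "y \<in> three_slope_map ` {0..1}"
      then obtain x where x: "x \<in> {0..1}" "y = three_slope_map x" by blast
      then show "y \<in> {0..1}"
        using strict_mono_on_less_eq[OF mono, of 0 x] strict_mono_on_less_eq[OF mono, of x 1] ends by simp
    qed
    show "{0..1} \<subseteq> three_slope_map ` {0..1}"
    proof
      fix y :: real assume "y \<in> {0..1}"
      then obtain x where "0 \<le> x" "x \<le> 1" "three_slope_map x = y"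
        using IVT'[of three_slope_map 0 y 1] ends cont by auto
      then show "y \<in> three_slope_map ` {0..1}" by force
    qed
  qed
  moreover have "inj_on three_slope_map {0..1}" using mono by (rule strict_mono_on_imp_inj_on)
  ultimately show "three_slope_map \<in> Bij {0..1}"
    unfolding Bij_def bij_betw_def by (simp add: three_slope_map_def)
  have fin: "finite {l, 1 - l\<^sup>2}" by simp
  show "piecewise_linear three_slope_map"
    unfolding piecewise_linear_def by (rule exI[of _ "{l, 1 - l\<^sup>2}"]) (use three_slope_map_affine in blast)
  show "breakpoints three_slope_map \<subseteq> A"
  proof
    fix x assume x: "x \<in> breakpoints three_slope_map"
    then have x01: "0 < x" "x < 1" unfolding breakpoints_def by auto
    have lA: "l \<in> A" using mult_A[OF one_A] by simp
    moreover have "1 - l\<^sup>2 \<in> A" using diff_A[OF one_A mult_A[OF lA]] by (simp add: power2_eq_square)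
    moreover have "x \<in> {l, 1 - l\<^sup>2}"
    proof (rule ccontr)
      assume xB: "x \<notin> {l, 1 - l\<^sup>2}"
      obtain d where d: "0 < d" "{x<..<x + d} \<inter> {l, 1 - l\<^sup>2} = {}" "{x - d<..<x} \<inter> {l, 1 - l\<^sup>2} = {}"
        by (rule finite_isolated[OF fin])
      define u where "u = max 0 (x - d)"
      define v where "v = min 1 (x + d)"
      have uv: "0 \<le> u" "u < x" "x < v" "v \<le> 1" unfolding u_def v_def using x01 d by auto
      have "{u<..<v} \<subseteq> {x - d<..<x} \<union> {x} \<union> {x<..<x + d}" unfolding u_def v_def by auto
      then have "{u<..<v} \<inter> {l, 1 - l\<^sup>2} = {}" using d xB by blast
      moreover have "u < v" using uv by simp
      ultimately obtain s where "affine_with_slope s three_slope_map {u..v}" using three_slope_map_affine uv by blast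
      then show False using not_breakpointI[of s three_slope_map u v x] uv x by blast
    qed
    ultimately show "x \<in> A" by auto
  qed
  show "slopes three_slope_map \<subseteq> int_powers l"
  proof
    fix m assume "m \<in> slopes three_slope_map"
    then obtain x y where xy: "0 \<le> x" "x < y" "y \<le> 1" "affine_with_slope m three_slope_map {x..y}"
      unfolding slopes_def by blast
    obtain d where d: "0 < d" "{x<..<x + d} \<inter> {l, 1 - l\<^sup>2} = {}"
      by (rule finite_isolated[OF fin])
    define z where "z = min y (x + d)"
    have z: "x < z" "z \<le> y" "z \<le> 1" unfolding z_def using xy d by auto
    have "{x<..<z} \<subseteq> {x<..<x + d}" unfolding z_def by auto
    then have "{x<..<z} \<inter> {l, 1 - l\<^sup>2} = {}" using d by blast
    then obtain s where s: "s \<in> int_powers l" "affine_with_slope s three_slope_map {x..z}"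
      using three_slope_map_affine xy z by blast
    have "m = s" using z by (intro slope_unique[OF xy(4) s(2), of x z]) auto
    then show "m \<in> int_powers l" using s by simp
  qed
qed

lemma three_slope_map_less:
  assumes "0 < t" "t < 1" shows "three_slope_map t < t"
proof -
  have "l * t < t" using l_less_1 assms by simp
  moreover have "l\<^sup>2 < l" using l_less_1 l_pos by (simp add: power2_eq_square)
  moreover have "(1 - t) * l < (1 - t) * 1"
    using l_less_1 assms by (intro mult_strict_left_mono) auto
  then have "1 - t < (1 - t) / l" using l_pos by (simp add: pos_less_divide_eq)
  ultimately show ?thesis using three_slope_map_apply[of t] assms by auto
qed

text \<open>Near an endpoint an element of the group is linear with slope a power of \<open>l\<close>, and
  \<open>three_slope_map\<close> has slope \<open>l\<close> at \<open>0\<close> and \<open>l\<inverse>\<close> at \<open>1\<close>, so its powers realize all these germs.\<close>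

theorem invariably_generated_PL_group: "invariably_generated (PL_group A (int_powers l))"
proof -
  let ?G = "PL_group A (int_powers l)"
  interpret homeo: increasing_homeo_group ?G by (rule increasing_homeo_group_PL)
  have germ: "\<exists>k. homeo.linear_germ z g (l powi k)" if g: "g \<in> carrier ?G" and z: "z \<in> {0, 1}" for g z
  proof (cases "z = 0")
    case True
    obtain e s where e: "0 < e" "0 + e \<le> 1" "affine_with_slope s g {0..0 + e}"
      by (rule piecewise_linear_right[OF PL_groupD(4)[OF g], of 0]) auto
    then have "s \<in> int_powers l" using PL_groupD(6)[OF g] slopesI[OF e(3)] by auto
    then obtain k where k: "s = l powi k" unfolding int_powers_def by blast
    obtain c where c: "\<And>t. t \<in> {0..e} \<Longrightarrow> g t = s * t + c"
      using e(3) unfolding affine_with_slope_def by auto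
    have c0: "c = 0" using c[of 0] e PL_group_ends[OF g] by simp
    have "\<forall>\<^sub>F t in at 0 within {0<..<1}. g t = 0 + s * (t - 0)"
      unfolding eventually_at by (rule exI[of _ e]) (use c c0 e in \<open>auto simp: dist_real_def\<close>)
    then show ?thesis using k True unfolding homeo.linear_germ_def by blast
  next
    case False
    then have z1: "z = 1" using z by simp
    obtain e s where e: "0 < e" "0 \<le> 1 - e" "affine_with_slope s g {1 - e..1}"
      by (rule piecewise_linear_left[OF PL_groupD(4)[OF g], of 1]) auto
    then have "s \<in> int_powers l" using PL_groupD(6)[OF g] slopesI[OF e(3)] by auto
    then obtain k where k: "s = l powi k" unfolding int_powers_def by blast
    obtain c where c: "\<And>t. t \<in> {1 - e..1} \<Longrightarrow> g t = s * t + c"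
      using e(3) unfolding affine_with_slope_def by auto
    have c1: "c = 1 - s" using c[of 1] e PL_group_ends[OF g] by simp
    have "\<forall>\<^sub>F t in at 1 within {0<..<1}. g t = 1 + s * (t - 1)"
      unfolding eventually_at by (rule exI[of _ e]) (use c c1 e in \<open>auto simp: dist_real_def algebra_simps\<close>)
    then show ?thesis using k z1 unfolding homeo.linear_germ_def by blast
  qed
  have gen0: "homeo.linear_germ 0 three_slope_map l"
    unfolding homeo.linear_germ_def eventually_at
    by (rule exI[of _ l]) (use l_pos three_slope_map_pieces(1) in \<open>auto simp: dist_real_def\<close>)
  have gen1: "homeo.linear_germ 1 three_slope_map (inverse l)"
    unfolding homeo.linear_germ_def eventually_at
  proof (intro exI[of _ "l\<^sup>2"] conjI ballI impI)
    fix t :: real assume "t \<in> {0<..<1}" "t \<noteq> 1 \<and> dist t 1 < l\<^sup>2"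
    then have "three_slope_map t = 1 - (1 - t) / l" by (intro three_slope_map_pieces(3)) (auto simp: dist_real_def)
    then show "three_slope_map t = 1 + inverse l * (t - 1)" by (simp add: divide_inverse algebra_simps)
  qed (use l_pos in simp)
  interpret cyclic_germs ?G three_slope_map
  proof unfold_locales
    show "three_slope_map \<in> carrier ?G" by (rule three_slope_map_in_PL_group)
    show "three_slope_map x < x" if "x \<in> {0<..<1}" for x using that three_slope_map_less by simp
    show "\<exists>k::int. homeo.same_germ z g (three_slope_map [^]\<^bsub>?G\<^esub> k)" if g: "g \<in> carrier ?G" and z: "z \<in> {0, 1}" for g z
    proof -
      obtain k where k: "homeo.linear_germ z g (l powi k)" using germ[OF g z] by blast
      have l0: "l \<noteq> 0" "inverse l \<noteq> 0" using l_pos by auto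
      show ?thesis
      proof (cases "z = 0")
        case True
        have "homeo.linear_germ 0 (three_slope_map [^]\<^bsub>?G\<^esub> k) (l powi k)"
          using homeo.linear_germ_int_pow[OF three_slope_map_in_PL_group _ gen0 l0(1)] by simp
        then show ?thesis using homeo.same_germ_if_linear_germ k True by blast
      next
        case False
        have "homeo.linear_germ 1 (three_slope_map [^]\<^bsub>?G\<^esub> (- k)) (inverse l powi (- k))"
          using homeo.linear_germ_int_pow[OF three_slope_map_in_PL_group _ gen1 l0(2)] by blast
        moreover have "inverse l powi (- k) = l powi k" by (simp add: power_int_minus power_int_inverse)
        ultimately have "homeo.linear_germ 1 (three_slope_map [^]\<^bsub>?G\<^esub> (- k)) (l powi k)" by (simp only:)
        then show ?thesis using homeo.same_germ_if_linear_germ k False z by blast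
      qed
    qed
  qed
  show ?thesis by (rule invariably_generated)
qed

end

section \<open>Higman--Thompson groups and the golden ratio group\<close>

lemma int_adjoinI: "poly (map_poly of_int p) x \<in> int_adjoin x"
  unfolding int_adjoin_def by blast

lemma map_poly_of_int_diff: "map_poly of_int (p - q) = (map_poly of_int p - map_poly of_int q :: real poly)"
  by (rule poly_eqI) (simp add: coeff_map_poly)

lemma zero_in_int_adjoin: "0 \<in> int_adjoin x"
  using int_adjoinI[of 0 x] by simp

lemma one_in_int_adjoin: "1 \<in> int_adjoin x"
  using int_adjoinI[of 1 x] by simp

lemma diff_in_int_adjoin:
  assumes "a \<in> int_adjoin x" "b \<in> int_adjoin x" shows "a - b \<in> int_adjoin x"
proof -
  obtain p q where "a = poly (map_poly of_int p) x" "b = poly (map_poly of_int q) x"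
    using assms unfolding int_adjoin_def by blast
  then have "a - b = poly (map_poly of_int (p - q)) x" by (simp add: map_poly_of_int_diff)
  then show ?thesis using int_adjoinI by metis
qed

lemma mult_in_int_adjoin:
  assumes "a \<in> int_adjoin x" shows "x * a \<in> int_adjoin x"
proof -
  obtain p where "a = poly (map_poly of_int p) x" using assms unfolding int_adjoin_def by blast
  then have "x * a = poly (map_poly of_int (pCons 0 p)) x" by (simp add: map_poly_pCons)
  then show ?thesis using int_adjoinI by metis
qed

lemma of_nat_mult_in_int_adjoin:
  assumes "a \<in> int_adjoin x" shows "real n * a \<in> int_adjoin x"
proof (induction n)
  case (Suc n)
  have "real (Suc n) * a = real n * a - (0 - a)" by (simp add: algebra_simps)
  then show ?case using diff_in_int_adjoin[OF Suc diff_in_int_adjoin[OF zero_in_int_adjoin assms]] by (simp only:)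
qed (use zero_in_int_adjoin in simp)

lemma invariably_generated_higman_thompson_F:
  assumes n: "2 \<le> n" shows "invariably_generated (higman_thompson_F n)"
proof -
  interpret cyclic_slopes "int_adjoin (1 / real n)" "1 / real n"
  proof
    show "a / (1 / real n) \<in> int_adjoin (1 / real n)" if "a \<in> int_adjoin (1 / real n)" for a
      using of_nat_mult_in_int_adjoin[OF that, of n] by (simp add: mult.commute)
    show "1 / real n * a \<in> int_adjoin (1 / real n)" if "a \<in> int_adjoin (1 / real n)" for a
      using mult_in_int_adjoin[OF that] .
    have "1 / real n \<le> 1 / 2" using n by (simp add: field_simps)
    moreover from this have "(1 / real n)\<^sup>2 \<le> (1 / 2)\<^sup>2" by (rule power_mono) simp
    ultimately show "1 / real n + (1 / real n)\<^sup>2 \<le> 1" by (simp add: power2_eq_square)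
  qed (use n zero_in_int_adjoin one_in_int_adjoin diff_in_int_adjoin in auto)
  show ?thesis
    using invariably_generated_PL_group int_powers_inverse[of "real n"]
    unfolding higman_thompson_F_def by (simp add: inverse_eq_divide)
qed

text \<open>The relation \<open>\<tau> + \<tau>\<^sup>2 = 1\<close> shows that \<open>\<tau>\<close> is a unit of \<open>\<int>[\<tau>]\<close> with inverse \<open>\<tau> + 1\<close>.\<close>

lemma invariably_generated_golden_F: "invariably_generated golden_F"
proof -
  have pos: "0 < golden_tau" unfolding golden_tau_def by (simp add: real_less_rsqrt)
  have eq: "golden_tau + golden_tau\<^sup>2 = 1"
    unfolding golden_tau_def by (simp add: power2_eq_square field_simps)
  interpret cyclic_slopes "int_adjoin golden_tau" golden_tau
  proof
    show "a / golden_tau \<in> int_adjoin golden_tau" if a: "a \<in> int_adjoin golden_tau" for a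
    proof -
      have "golden_tau * (golden_tau * a - (0 - a)) = (golden_tau + golden_tau\<^sup>2) * a"
        by (simp add: algebra_simps power2_eq_square)
      then have "a / golden_tau = golden_tau * a - (0 - a)" using eq pos by (simp add: field_simps)
      then show ?thesis using a diff_in_int_adjoin mult_in_int_adjoin zero_in_int_adjoin by metis
    qed
  qed (use pos eq zero_in_int_adjoin one_in_int_adjoin diff_in_int_adjoin mult_in_int_adjoin in auto)
  show ?thesis using invariably_generated_PL_group unfolding golden_F_def .
qed

theorem theorem1p2:
  shows "(\<forall>n::nat. n \<ge> 3 \<longrightarrow> invariably_generated (higman_thompson_F n)) \<and>
         invariably_generated golden_F"
  using invariably_generated_higman_thompson_F invariably_generated_golden_F by simp

end
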